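(* Let $n\ge 8$ be an integer and define $$ f(n)=\begin{cases} 2n-\lfloor n/8\rfloor & \text{if } n\equiv 0,\,4,\,7 \pmod 8,\\ 2n+1-\lfloor n/8\rfloor & \text{otherwise.} \end{cases} $$ Then the minimum size of a $3$-connected locally nonforesty graph of order $n$ is $f(n)$. (That is, every $3$-connected locally nonforesty graph of order $n$ has size at least $f(n)$, and there exists a $3$-connected locally nonforesty graph of order $n$ and size exactly $f(n)$.)
   Context: All graphs are finite and simple. The order of a graph is its number of vertices, and the size of a graph is its number of edges. For a vertex $x$ of a graph $G$, $N(x)$ denotes the (open) neighborhood of $x$, i.e. the set of vertices adjacent to $x$. A local subgraph of $G$ is the subgraph of $G$ induced by the neighborhood $N(x)$ of a vertex $x$. A graph $G$ is called locally nonforesty if every local subgraph of $G$ contains a cycle, i.e. for every vertex $x$ of $G$ the induced subgraph $G[N(x)]$ contains a cycle. *)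

theory Defs
  imports "Graph_Theory.Digraph_Component"
begin

text \<open>
  A finite simple graph is an instance of the locale \<^locale>\<open>graph\<close>: a finite symmetric
  digraph without loops and parallel arcs. Each undirected edge is thus a pair of opposite arcs,
  so edges are counted as two-element sets of vertices rather than as arcs.
\<close>

definition edge_set :: "('a, 'b) pre_digraph \<Rightarrow> 'a set set" where
  "edge_set G = {{u, v} | u v. u \<rightarrow>\<^bsub>G\<^esub> v}"

definition graph_order :: "('a, 'b) pre_digraph \<Rightarrow> nat" where
  "graph_order G = card (verts G)"

definition graph_size :: "('a, 'b) pre_digraph \<Rightarrow> nat" where
  "graph_size G = card (edge_set G)"

definition neighborhood :: "('a, 'b) pre_digraph \<Rightarrow> 'a \<Rightarrow> 'a set" where
  "neighborhood G x = {y. x \<rightarrow>\<^bsub>G\<^esub> y}"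

text \<open>
  In a symmetric digraph, \<^const>\<open>pre_digraph.cycle\<close> also accepts the closed walk
  \<open>u, v, u\<close> along an arc and its reverse. The length condition excludes it, leaving exactly
  the cycles of the undirected graph.
\<close>

definition contains_cycle :: "('a, 'b) pre_digraph \<Rightarrow> bool" where
  "contains_cycle G \<longleftrightarrow> (\<exists>p. pre_digraph.cycle G p \<and> 3 \<le> length p)"

definition locally_nonforesty :: "('a, 'b) pre_digraph \<Rightarrow> bool" where
  "locally_nonforesty G \<longleftrightarrow> (\<forall>x \<in> verts G. contains_cycle (G \<restriction> neighborhood G x))"

definition k_connected :: "nat \<Rightarrow> ('a, 'b) pre_digraph \<Rightarrow> bool" where
  "k_connected k G \<longleftrightarrow> k < graph_order G \<and>
     (\<forall>X \<subseteq> verts G. card X < k \<longrightarrow> connected (G \<restriction> (verts G - X)))"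

definition extremal_f :: "nat \<Rightarrow> nat" where
  "extremal_f n =
     (if n mod 8 \<in> {0, 4, 7} then 2 * n - n div 8 else 2 * n + 1 - n div 8)"

end

theory Submission
  imports Defs
begin

text \<open>
  A vertex \<open>x\<close> of degree three lies in a complete graph \<open>K\<^sub>4\<close> on its closed neighbourhood, and
  3-connectivity makes its neighbours have degree at least four and \<open>x\<close> the only vertex of degree three in
  this \<open>K\<^sub>4\<close>. Neighbours shared by several vertices of degree three pay for it with a larger degree.
  Discharging along these lines gives \<open>8m \<ge> 15n\<close> for order \<open>n\<close> and size \<open>m\<close>, and the structure of the
  near-extremal graphs rules out \<open>8m - 15n \<in> {1, 2, 3, 5, 6}\<close>. Since \<open>8m - 15n \<equiv> n\<close> modulo 8, this is the
  lower bound. Conversely, deleting two disjoint edges \<open>uv\<close> and \<open>u'v'\<close> and rerouting each through a new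
  \<open>K\<^sub>4\<close>, with one more edge between the two copies of \<open>K\<^sub>4\<close>, adds 8 vertices and 15 edges and preserves
  both properties, so only the orders from 8 to 15 need explicit graphs.
\<close>

section \<open>Connectivity and cycles in induced subgraphs\<close>

text \<open>The constants come from vertex sets partitioned into copies of \<open>K\<^sub>4\<close>
  with degrees 3, 4, 4, 4: fifteen half-edges on four vertices. Measured against this pattern, a
  vertex of degree four without a neighbour of degree three costs 1, each unit of degree above four
  costs 4, and each repeated membership of a vertex in such copies gains 1. Except in graphs too
  dense to matter, a repeated membership forces a unit of degree, so its net cost is at least 3 and
  few configurations have a small defect. The value 4 comes from a \<open>K\<^sub>4\<close> whose
  vertices all have degree four, the value 7 from two copies that share one vertex of degree six.
  Together with 0 these are the exceptional residues of \<open>extremal_f\<close>; any other residue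
  \<open>j\<close> has to wait for the defect \<open>j + 8\<close>, which is one more edge. The
  extension by eight vertices keeps the defect because 8 * 15 = 15 * 8, so one graph per residue
  suffices.\<close>

definition conn_on :: "'a set \<Rightarrow> ('a \<Rightarrow> 'a \<Rightarrow> bool) \<Rightarrow> bool" where
  "conn_on W E \<longleftrightarrow> (\<forall>P :: 'a \<Rightarrow> bool.
     (\<forall>u\<in>W. \<forall>v\<in>W. E u v \<longrightarrow> P u = P v) \<longrightarrow> (\<forall>u\<in>W. \<forall>v\<in>W. P u = P v))"

lemma conn_onD:
  fixes P :: "'a \<Rightarrow> bool"
  assumes "conn_on W E" "\<And>u v. u \<in> W \<Longrightarrow> v \<in> W \<Longrightarrow> E u v \<Longrightarrow> P u = P v" "u \<in> W" "v \<in> W"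
  shows "P u = P v"
  by (rule assms(1)[unfolded conn_on_def, rule_format, of P, OF assms(2-4)])

lemma arcs_ends_induce:
  assumes "W \<subseteq> verts G"
  shows "arcs_ends (G \<restriction> W) = arcs_ends G \<inter> W \<times> W"
  by (auto simp: arcs_ends_conv induce_subgraph_def)

text \<open>Testing connectivity by two-valued functions that are constant along edges avoids walks.
  The lower bound takes \<open>P\<close> to be membership in a separated set; the extension argument
  propagates values of \<open>P\<close> along edges. The empty set satisfies \<open>conn_on\<close>,
  hence the separate conjunct.\<close>

lemma connected_induce_iff:
  assumes "symmetric G" "W \<subseteq> verts G"
  shows "connected (G \<restriction> W) \<longleftrightarrow> W \<noteq> {} \<and> conn_on W (\<lambda>u v. u \<rightarrow>\<^bsub>G\<^esub> v)"
proof -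
  define A where "A = arcs_ends G \<inter> W \<times> W"
  have "symcl A = A"
    using assms(1) by (auto simp: A_def symcl_def symmetric_def sym_def)
  then have conv: "connected (G \<restriction> W) \<longleftrightarrow> W \<noteq> {} \<and> (\<forall>u\<in>W. \<forall>v\<in>W. (u,v) \<in> rtrancl_on W A)"
    by (simp add: connected_conv arcs_ends_induce assms(2) A_def)
  have "(\<forall>u\<in>W. \<forall>v\<in>W. (u,v) \<in> rtrancl_on W A) \<longleftrightarrow> conn_on W (\<lambda>u v. u \<rightarrow>\<^bsub>G\<^esub> v)"
  proof (intro iffI ballI)
    assume reach: "\<forall>u\<in>W. \<forall>v\<in>W. (u,v) \<in> rtrancl_on W A"
    show "conn_on W (\<lambda>u v. u \<rightarrow>\<^bsub>G\<^esub> v)"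
      unfolding conn_on_def
    proof (intro allI impI ballI)
      fix P u v
      assume P: "\<forall>u\<in>W. \<forall>v\<in>W. u \<rightarrow>\<^bsub>G\<^esub> v \<longrightarrow> P u = P v" and "u \<in> W" "v \<in> W"
      then have "(u,v) \<in> rtrancl_on W A" using reach by blast
      then show "P u = P v"
      proof induct
        case (step y z)
        then show ?case using P[rule_format, of y z] by (simp add: A_def)
      qed simp
    qed
  next
    fix u v
    assume conn: "conn_on W (\<lambda>u v. u \<rightarrow>\<^bsub>G\<^esub> v)" and uv: "u \<in> W" "v \<in> W"
    have "((u,u) \<in> rtrancl_on W A) = ((u,v) \<in> rtrancl_on W A)"
    proof (rule conn_onD[OF conn _ uv, where P = "\<lambda>w. (u,w) \<in> rtrancl_on W A"])
      fix x y assume "x \<in> W" "y \<in> W" "x \<rightarrow>\<^bsub>G\<^esub> y"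
      moreover have "y \<rightarrow>\<^bsub>G\<^esub> x"
        using assms(1) \<open>x \<rightarrow>\<^bsub>G\<^esub> y\<close> by (auto simp: symmetric_def sym_def)
      ultimately show "((u,x) \<in> rtrancl_on W A) = ((u,y) \<in> rtrancl_on W A)"
        by (auto simp: A_def intro: rtrancl_on_into_rtrancl_on)
    qed
    then show "(u,v) \<in> rtrancl_on W A" using uv by simp
  qed
  with conv show ?thesis by simp
qed

lemma (in pre_digraph) cas_nth:
  assumes "cas u p v" "Suc i < length p"
  shows "tail G (p ! Suc i) = head G (p ! i)"
  using assms
proof (induction p arbitrary: u i)
  case (Cons e p)
  show ?case
  proof (cases i)
    case 0
    then show ?thesis using Cons.prems by (cases p) simp_all
  next
    case (Suc j)
    then show ?thesis using Cons.IH[of "head G e" j] Cons.prems by simp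
  qed
qed simp

lemma (in pre_digraph) cas_hd_last:
  assumes "cas u p v" "p \<noteq> []"
  shows "tail G (p ! 0) = u" "head G (p ! (length p - 1)) = v"
proof -
  show "tail G (p ! 0) = u" using assms by (cases p) auto
  show "head G (p ! (length p - 1)) = v"
    using assms
  proof (induction p arbitrary: u)
    case (Cons e p)
    show ?case
    proof (cases "p = []")
      case False
      then have "head G (p ! (length p - 1)) = v"
        using Cons.IH[of "head G e"] Cons.prems by simp
      then show ?thesis using False by (simp add: nth_Cons')
    qed (use Cons.prems in simp)
  qed simp
qed

text \<open>The vertices of a cycle have minimum degree two among themselves. The lower bound uses
  local cycles only through this property, so its counting needs no walks.\<close>

lemma contains_cycle_imp_min_degree_two:
  assumes "symmetric G" "W \<subseteq> verts G" "contains_cycle (G \<restriction> W)"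
  obtains S where "S \<subseteq> W" "S \<noteq> {}"
    "\<And>y. y \<in> S \<Longrightarrow> \<exists>a\<in>S. \<exists>b\<in>S. a \<noteq> b \<and> y \<rightarrow>\<^bsub>G\<^esub> a \<and> y \<rightarrow>\<^bsub>G\<^esub> b"
proof -
  let ?H = "G \<restriction> W"
  obtain p u where p: "pre_digraph.awalk ?H u p u" "distinct (tl (pre_digraph.awalk_verts ?H u p))"
    and len: "3 \<le> length p"
    using assms(3) unfolding contains_cycle_def pre_digraph.cycle_def by auto
  let ?k = "length p"
  have cas: "pre_digraph.cas ?H u p u" and arcs: "set p \<subseteq> arcs ?H"
    using p(1) by (auto simp: pre_digraph.awalk_def)
  have ne: "p \<noteq> []" using len by auto
  have dist: "distinct (map (head G) p)"
    using p(2) ne by (simp add: pre_digraph.awalk_verts_conv'[OF cas])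
  have next_tail: "tail G (p ! (Suc i mod ?k)) = head G (p ! i)" if "i < ?k" for i
  proof (cases "Suc i < ?k")
    case True
    then show ?thesis using pre_digraph.cas_nth[OF cas] by simp
  next
    case False
    then have "Suc i = ?k" "i = ?k - 1" using that by auto
    then show ?thesis
      using pre_digraph.cas_hd_last[OF cas ne] by simp
  qed
  have arc: "tail G e \<rightarrow>\<^bsub>G\<^esub> head G e" "head G e \<in> W" if "e \<in> set p" for e
    using that arcs by (auto simp: arcs_ends_conv induce_subgraph_def)
  have symD: "v \<rightarrow>\<^bsub>G\<^esub> u" if "u \<rightarrow>\<^bsub>G\<^esub> v" for u v
    using that assms(1) by (auto simp: symmetric_def sym_def)
  have deg: "\<exists>a\<in>head G ` set p. \<exists>b\<in>head G ` set p. a \<noteq> b \<and> y \<rightarrow>\<^bsub>G\<^esub> a \<and> y \<rightarrow>\<^bsub>G\<^esub> b"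
    if y: "y \<in> head G ` set p" for y
  proof -
    obtain i where i: "i < ?k" "y = head G (p ! i)"
      using y by (auto simp: in_set_conv_nth)
    \<comment> \<open>Positions \<open>j\<close> and \<open>l\<close> precede and follow
      \<open>i\<close> cyclically. In a closed walk of length two they would coincide; here the
      length condition enters.\<close>
    define j where "j = (if i = 0 then ?k - 1 else i - 1)"
    define l where "l = Suc i mod ?k"
    have j: "j < ?k" "i = Suc j mod ?k" using i len by (auto simp: j_def)
    have l: "l < ?k" using ne by (simp add: l_def)
    have "j \<noteq> l"
      using i(1) len by (cases "Suc i = ?k") (auto simp: j_def l_def)
    then have "head G (p ! j) \<noteq> head G (p ! l)"
      using dist j(1) l by (simp add: distinct_conv_nth)
    moreover have "head G (p ! j) \<rightarrow>\<^bsub>G\<^esub> y"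
      using arc(1)[of "p ! i"] next_tail[OF j(1)] i by (simp flip: j(2))
    moreover have "y \<rightarrow>\<^bsub>G\<^esub> head G (p ! l)"
      using arc(1)[of "p ! l"] next_tail[OF i(1)] i(2) l by (simp flip: l_def)
    ultimately show ?thesis using j(1) l symD by (meson imageI nth_mem)
  qed
  show thesis
    by (rule that[of "head G ` set p"]) (use arc(2) ne deg in auto)
qed

lemma contains_cycle_triangle:
  assumes "W \<subseteq> verts G" "{a,b,c} \<subseteq> W" "a \<noteq> b" "b \<noteq> c" "a \<noteq> c"
    and "a \<rightarrow>\<^bsub>G\<^esub> b" "b \<rightarrow>\<^bsub>G\<^esub> c" "c \<rightarrow>\<^bsub>G\<^esub> a"
  shows "contains_cycle (G \<restriction> W)"
proof -
  obtain e where e: "e \<in> arcs G" "tail G e = a" "head G e = b" using assms(6) by blast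
  obtain f where f: "f \<in> arcs G" "tail G f = b" "head G f = c" using assms(7) by blast
  obtain g where g: "g \<in> arcs G" "tail G g = c" "head G g = a" using assms(8) by blast
  have "pre_digraph.cycle (G \<restriction> W) [e,f,g]"
    unfolding pre_digraph.cycle_def
    using assms(2-5) e f g
    by (intro exI[of _ a])
       (auto simp: pre_digraph.awalk_def pre_digraph.cas.simps pre_digraph.awalk_verts.simps
          induce_subgraph_def)
  then show ?thesis unfolding contains_cycle_def by (intro exI[of _ "[e,f,g]"]) simp
qed

text \<open>Each edge has exactly two orientations, distinct because there are no loops.\<close>

lemma (in graph) two_graph_size_eq_card_arcs_ends:
  "2 * graph_size G = card (arcs_ends G)"
proof -
  have fin: "finite (arcs_ends G)" by (simp add: arcs_ends_def)
  have sym: "(v,u) \<in> arcs_ends G" if "(u,v) \<in> arcs_ends G" for u v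
    using that by (rule graph_symmetric)
  have ne: "u \<noteq> v" if "(u,v) \<in> arcs_ends G" for u v using that adj_not_same by auto
  have edges: "edge_set G = (\<lambda>(u,v). {u,v}) ` arcs_ends G" by (auto simp: edge_set_def)
  have "card (arcs_ends G) = (\<Sum>e\<in>edge_set G. card {x \<in> arcs_ends G. (\<lambda>(u,v). {u,v}) x = e})"
    using fin unfolding edges card_eq_sum by (rule sum.image_gen)
  also have "\<dots> = (\<Sum>e\<in>edge_set G. 2)"
  proof (rule sum.cong[OF refl])
    fix e assume "e \<in> edge_set G"
    then obtain u v where uv: "(u,v) \<in> arcs_ends G" "e = {u,v}" by (auto simp: edge_set_def)
    then have "{x \<in> arcs_ends G. (\<lambda>(u,v). {u,v}) x = e} = {(u,v),(v,u)}"
      using sym by (auto simp: doubleton_eq_iff)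
    then show "card {x \<in> arcs_ends G. (\<lambda>(u,v). {u,v}) x = e} = 2"
      using ne[OF uv(1)] by simp
  qed
  finally show ?thesis by (simp add: graph_size_def)
qed

section \<open>The lower bound\<close>

text \<open>Both graph properties take the form that the counting uses: a nonempty set with all
  outside neighbours among at most two vertices fills the complement of these, and a local cycle is
  a nonempty set of minimum degree two inside a neighbourhood.\<close>

locale local_cycle_graph =
  fixes V :: "'a set" and N :: "'a \<Rightarrow> 'a set"
  assumes finite_V: "finite V"
    and N_subset: "N x \<subseteq> V"
    and N_sym: "y \<in> N x \<Longrightarrow> x \<in> N y"
    and N_irrefl: "x \<notin> N x"
    and three_connected: "\<lbrakk>X \<subseteq> V; card X < 3; S \<subseteq> V - X; S \<noteq> {}; \<And>u. u \<in> S \<Longrightarrow> N u \<subseteq> S \<union> X\<rbrakk>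
      \<Longrightarrow> S = V - X"
    and local_cycle: "x \<in> V \<Longrightarrow> \<exists>S \<subseteq> N x. S \<noteq> {} \<and> (\<forall>y\<in>S. \<exists>a\<in>S. \<exists>b\<in>S. a \<noteq> b \<and> a \<in> N y \<and> b \<in> N y)"
    and card_V: "8 \<le> card V"
begin

definition local_cycle_set :: "'a \<Rightarrow> 'a set \<Rightarrow> bool" where
  "local_cycle_set x S \<longleftrightarrow> S \<subseteq> N x \<and> S \<noteq> {} \<and>
     (\<forall>y\<in>S. \<exists>a\<in>S. \<exists>b\<in>S. a \<noteq> b \<and> a \<in> N y \<and> b \<in> N y)"

definition T :: "'a set" where "T = {x \<in> V. card (N x) = 3}"
definition A :: "'a set" where "A = (\<Union>x\<in>T. N x)"
definition R :: "'a set" where "R = V - T - A"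

lemma finite_N [simp]: "finite (N x)"
  using N_subset finite_V finite_subset by blast

lemma T_subset: "T \<subseteq> V" by (auto simp: T_def)

lemma finite_T [simp]: "finite T"
  using T_subset finite_V finite_subset by blast

lemma A_subset: "A \<subseteq> V" using N_subset by (auto simp: A_def)

lemma finite_A [simp]: "finite A"
  using A_subset finite_V finite_subset by blast

lemma finite_R [simp]: "finite R" using finite_V by (simp add: R_def)

text \<open>Together with \<open>p\<close> and \<open>q\<close> such a set would be all of
  \<open>V\<close>, with at most seven vertices; the bound 5 is thus the one for order eight. Most
  configurations excluded below contradict this.\<close>

lemma no_small_separation:
  assumes "S \<subseteq> V" "S \<noteq> {}" "card S \<le> 5" "p \<in> V" "q \<in> V" "p \<notin> S" "q \<notin> S"
    and "\<And>u. u \<in> S \<Longrightarrow> N u \<subseteq> S \<union> {p,q}"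
  shows False
proof -
  have "card {p,q} \<le> 2" by (simp add: card_insert_if)
  then have "S = V - {p,q}"
    using assms by (intro three_connected) auto
  then have "V = S \<union> {p,q}" using assms by auto
  then have "card V \<le> card S + card {p,q}" by (metis card_Un_le)
  with \<open>card {p,q} \<le> 2\<close> show False using assms(3) card_V by linarith
qed

section \<open>Local cycles and vertices of degree three\<close>

lemma local_cycle_setE:
  assumes "x \<in> V" obtains S where "local_cycle_set x S"
  using local_cycle[OF assms] unfolding local_cycle_set_def by blast

lemma local_cycle_set_nbrs:
  assumes "local_cycle_set x S" "y \<in> S"
  obtains a b where "a \<in> S" "b \<in> S" "a \<noteq> b" "a \<in> N y" "b \<in> N y" "card {y,a,b} = 3"
proof -
  obtain a b where "a \<in> S" "b \<in> S" "a \<noteq> b" "a \<in> N y" "b \<in> N y"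
    using assms unfolding local_cycle_set_def by blast
  moreover have "a \<noteq> y" "b \<noteq> y" using calculation N_irrefl by auto
  ultimately show thesis using that by simp
qed

lemma local_cycle_set_subset: "local_cycle_set x S \<Longrightarrow> S \<subseteq> N x"
  by (simp add: local_cycle_set_def)

lemma local_cycle_set_finite: "local_cycle_set x S \<Longrightarrow> finite S"
  using local_cycle_set_subset finite_N finite_subset by blast

lemma local_cycle_set_card:
  assumes "local_cycle_set x S" shows "3 \<le> card S"
proof -
  obtain y where y: "y \<in> S" using assms by (auto simp: local_cycle_set_def)
  obtain a b where "a \<in> S" "b \<in> S" "card {y,a,b} = 3"
    by (rule local_cycle_set_nbrs[OF assms y]) (rule that)
  then show ?thesis
    using card_mono[OF local_cycle_set_finite[OF assms], of "{y,a,b}"] y by simp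
qed

lemma local_cycle_set_card3:
  assumes "local_cycle_set x S" "card S = 3" "y \<in> S" "z \<in> S" "y \<noteq> z"
  shows "z \<in> N y"
proof -
  obtain a b where ab: "a \<in> S" "b \<in> S" "a \<in> N y" "b \<in> N y" "card {y,a,b} = 3"
    by (rule local_cycle_set_nbrs[OF assms(1,3)]) (rule that)
  then have "{y,a,b} = S"
    using assms local_cycle_set_finite by (intro card_subset_eq) auto
  then show ?thesis using assms ab by auto
qed

lemma deg_ge_3: "x \<in> V \<Longrightarrow> 3 \<le> card (N x)"
  by (meson card_mono finite_N le_trans local_cycle_setE local_cycle_set_card local_cycle_set_subset)

text \<open>A local cycle has at least three vertices, so with only three neighbours it is the whole
  neighbourhood and a triangle.\<close>

lemma T_clique:
  assumes "x \<in> T" "y \<in> N x" "z \<in> N x" "y \<noteq> z"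
  shows "z \<in> N y"
proof -
  have x: "x \<in> V" "card (N x) = 3" using assms(1) by (auto simp: T_def)
  obtain S where S: "local_cycle_set x S" using x(1) by (rule local_cycle_setE)
  then have "S = N x"
    using local_cycle_set_card[OF S] local_cycle_set_subset[OF S] x(2) by (intro card_seteq) auto
  then show ?thesis using local_cycle_set_card3[OF S] x(2) assms by auto
qed

lemma T_nbrsE:
  assumes "x \<in> T" "a \<in> N x"
  obtains b c where "N x = {a,b,c}" "a \<noteq> b" "a \<noteq> c" "b \<noteq> c"
    "b \<in> N a" "c \<in> N a" "a \<in> N b" "c \<in> N b" "a \<in> N c" "b \<in> N c" "x \<in> N a" "x \<in> N b" "x \<in> N c"
    "a \<in> V" "b \<in> V" "c \<in> V"
proof -
  have "card (N x - {a}) = 2" using assms by (simp add: T_def)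
  then obtain b c where "N x - {a} = {b,c}" "b \<noteq> c" by (auto simp: card_2_iff)
  then have bc: "N x = {a,b,c}" "b \<noteq> c" "a \<noteq> b" "a \<noteq> c" using assms(2) by auto
  show thesis
    by (rule that[of b c]) (use bc T_clique[OF assms(1)] N_sym N_subset[of x] in auto)
qed

lemma T_two_nbrsE:
  assumes "x \<in> T" "a \<in> N x" "b \<in> N x" "a \<noteq> b"
  obtains c where "N x = {a,b,c}" "a \<noteq> c" "b \<noteq> c" "b \<in> N a" "a \<in> N b"
    "c \<in> N a" "c \<in> N b" "x \<in> N c" "c \<in> V"
proof -
  obtain p q where pq: "N x = {a,p,q}" "a \<noteq> p" "a \<noteq> q" "p \<noteq> q"
    "p \<in> N a" "q \<in> N a" "a \<in> N p" "q \<in> N p" "a \<in> N q" "p \<in> N q" "x \<in> N p" "x \<in> N q"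
    "p \<in> V" "q \<in> V"
    by (rule T_nbrsE[OF assms(1,2)]) (rule that)
  consider "b = p" | "b = q" using pq(1) assms(3,4) by auto
  then show thesis
  proof cases
    case 1
    show thesis by (rule that[of q]) (use pq 1 in auto)
  next
    case 2
    show thesis by (rule that[of p]) (use pq 2 in auto)
  qed
qed

text \<open>Adjacent vertices of degree three have the same two other neighbours by
  \<open>T_clique\<close>, and these two would separate them from the rest.\<close>

lemma T_indep:
  assumes "x \<in> T" "y \<in> N x" shows "y \<notin> T"
proof
  assume "y \<in> T"
  obtain p q where pq: "N x = {y,p,q}" "y \<noteq> p" "y \<noteq> q" "p \<noteq> q" "p \<in> N y" "q \<in> N y"
    "x \<in> N y" "p \<in> V" "q \<in> V"
    by (rule T_nbrsE[OF assms]) (rule that)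
  have x: "x \<noteq> p" "x \<noteq> q" using pq N_irrefl[of x] by auto
  have "{x,p,q} = N y"
    using pq x \<open>y \<in> T\<close> by (intro card_subset_eq) (auto simp: T_def)
  then show False
    using pq x assms \<open>y \<in> T\<close> T_subset
    by (intro no_small_separation[of "{x,y}" p q]) (auto simp: card_insert_if)
qed

lemma T_N_disjoint: "x \<in> T \<Longrightarrow> N x \<inter> T = {}"
  using T_indep by auto

lemma A_T_disjoint: "A \<inter> T = {}"
  using T_N_disjoint by (auto simp: A_def)

lemma deg_ge_4: "a \<in> V \<Longrightarrow> a \<notin> T \<Longrightarrow> 4 \<le> card (N a)"
  using deg_ge_3[of a] by (auto simp: T_def)

lemma A_iff: "a \<in> A \<longleftrightarrow> N a \<inter> T \<noteq> {}"
  unfolding A_def using N_sym by blast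

section \<open>The dense exception and the structure of graphs with small defect\<close>

text \<open>The hypothesis forces the join of a triangle with an independent set, which has too many edges
  to matter. In all other graphs a vertex in \<open>A\<close> has three neighbours outside \<open>T\<close>.\<close>
lemma few_outer_nbrs_size:
  assumes "a \<in> V" "N a \<inter> T \<noteq> {}" "card (N a - T) < 3"
  shows "6 * card V - 12 \<le> (\<Sum>x\<in>V. card (N x))"
proof -
  obtain x where x: "x \<in> T" "x \<in> N a" using assms(2) by auto
  obtain b c where bc: "N x = {a,b,c}" "a \<noteq> b" "a \<noteq> c" "b \<noteq> c"
    "b \<in> N a" "c \<in> N a" "a \<in> N b" "c \<in> N b" "a \<in> N c" "b \<in> N c" "b \<in> V" "c \<in> V"
    by (rule T_nbrsE[OF x(1) N_sym[OF x(2)]]) (rule that)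
  have abcT: "a \<notin> T" "b \<notin> T" "c \<notin> T" using T_indep[OF x(1)] bc(1) by auto
  have "{b,c} = N a - T"
    using bc abcT assms(3) by (intro card_seteq) auto
  \<comment> \<open>The other neighbours of \<open>y\<close> are adjacent to \<open>a\<close> and
    lie outside \<open>T\<close>, so they are \<open>b\<close> and \<open>c\<close>. Hence
    \<open>a\<close> and its neighbours in \<open>T\<close> have only \<open>b\<close> and
    \<open>c\<close> as outside neighbours.\<close>
  have Na: "N y = {a,b,c}" if "y \<in> N a \<inter> T" for y
  proof (rule card_seteq)
    have "a \<in> N y" using that N_sym by auto
    then show "N y \<subseteq> {a,b,c}"
      using T_clique[of y a] T_indep[of y] that \<open>{b,c} = N a - T\<close> by blast
    show "card {a,b,c} \<le> card (N y)" using that bc by (simp add: T_def)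
  qed simp
  have "insert a (N a \<inter> T) = V - {b,c}"
  proof (rule three_connected)
    show "N u \<subseteq> insert a (N a \<inter> T) \<union> {b,c}" if "u \<in> insert a (N a \<inter> T)" for u
      using that Na \<open>{b,c} = N a - T\<close> by auto
  qed (use bc abcT assms N_subset in \<open>auto simp: card_insert_if\<close>)
  then have V: "V = insert a (N a \<inter> T) \<union> {b,c}" using bc by auto
  have full: "card V - 1 \<le> card (N y)" if "y \<in> {a,b,c}" for y
  proof -
    have "V - {y} \<subseteq> N y"
    proof
      fix z assume z: "z \<in> V - {y}"
      show "z \<in> N y"
      proof (cases "z \<in> {a,b,c}")
        case True
        then show ?thesis using z that bc by auto
      next
        case False
        then have "z \<in> N a \<inter> T" using z V by blast
        then have "y \<in> N z" using Na that by simp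
        then show ?thesis by (rule N_sym)
      qed
    qed
    then have "card (V - {y}) \<le> card (N y)" by (intro card_mono) auto
    then show ?thesis using that bc assms(1) by auto
  qed
  have sub: "{a,b,c} \<subseteq> V" using bc assms(1) by auto
  have c3: "card {a,b,c} = 3" using bc by simp
  \<comment> \<open>With \<open>n = card V\<close>, three vertices have degree at least
    \<open>n - 1\<close> and the others at least 3, which gives
    \<open>3 * (n - 1) + 3 * (n - 3)\<close>.\<close>
  have "(\<Sum>y\<in>V. card (N y)) = (\<Sum>y\<in>V - {a,b,c}. card (N y)) + (\<Sum>y\<in>{a,b,c}. card (N y))"
    using sub finite_V by (rule sum.subset_diff)
  moreover have "card (V - {a,b,c}) * 3 \<le> (\<Sum>y\<in>V - {a,b,c}. card (N y))"
    using deg_ge_3 sum_bounded_below[of "V - {a,b,c}" 3 "\<lambda>y. card (N y)"] by simp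
  moreover have "card {a,b,c} * (card V - 1) \<le> (\<Sum>y\<in>{a,b,c}. card (N y))"
    using full sum_bounded_below[of "{a,b,c}" "card V - 1" "\<lambda>y. card (N y)"] by simp
  moreover have "card (V - {a,b,c}) = card V - 3"
    using sub c3 by (simp add: card_Diff_subset)
  ultimately show ?thesis using c3 by simp
qed

text \<open>Suppose that \<open>a\<close> in \<open>S\<close> lies in \<open>A\<close> and has
  degree four. Its neighbours are \<open>x\<close>, \<open>b\<close>, \<open>c\<close>,
  \<open>w\<close> with \<open>x\<close> in \<open>T\<close>; since \<open>w\<close> has no
  neighbour in \<open>T\<close>, the two neighbours of \<open>a\<close> in \<open>S\<close> are
  \<open>b\<close> and \<open>c\<close>. If \<open>b\<close> had degree four too,
  \<open>{c,w}\<close> would separate \<open>{x,a,b}\<close>, and likewise with \<open>b\<close> and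
  \<open>c\<close> exchanged. So both have degree at least five, against the bound on such
  vertices.\<close>

lemma local_cycle_in_R:
  assumes t: "\<And>a. a \<in> A \<Longrightarrow> card (N a \<inter> T) = 1"
    and Z: "card {z \<in> A. 5 \<le> card (N z)} \<le> 1"
    and w: "w \<in> R" and S: "local_cycle_set w S"
  shows "S \<subseteq> (R - {w}) \<union> {z \<in> A. 5 \<le> card (N z)}"
proof
  fix a assume a: "a \<in> S"
  have SN: "S \<subseteq> N w" using S by (rule local_cycle_set_subset)
  have wT: "N w \<inter> T = {}" "w \<in> V" "w \<notin> A" "w \<notin> T" using w A_iff[of w] by (auto simp: R_def)
  have aV: "a \<in> V" "a \<notin> T" "a \<noteq> w" using a SN N_subset wT N_irrefl[of w] by auto
  have "5 \<le> card (N a)" if "a \<in> A"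
  proof (rule ccontr)
    assume "\<not> 5 \<le> card (N a)"
    then have a4: "card (N a) = 4" using deg_ge_4[OF aV(1,2)] by simp
    have nbr4: "N y = {x,y',y'',w}"
      if "{x,y',y'',w} \<subseteq> N y" "card (N y) = 4" "card {x,y',y'',w} = 4" for x y y' y''
      using that by (intro card_subset_eq[symmetric]) auto
    obtain x where x: "N a \<inter> T = {x}" using t[OF \<open>a \<in> A\<close>] by (auto simp: card_1_singleton_iff)
    then have xT: "x \<in> T" "a \<in> N x" using N_sym by auto
    obtain b c where bc: "N x = {a,b,c}" "a \<noteq> b" "a \<noteq> c" "b \<noteq> c"
      "b \<in> N a" "c \<in> N a" "a \<in> N b" "c \<in> N b" "a \<in> N c" "b \<in> N c" "x \<in> N a" "x \<in> N b" "x \<in> N c"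
      "b \<in> V" "c \<in> V"
      by (rule T_nbrsE[OF xT]) (rule that)
    have bcA: "b \<in> A" "c \<in> A" using bc xT by (auto simp: A_def)
    have wne: "w \<noteq> a" "w \<noteq> b" "w \<noteq> c" "w \<noteq> x" using bcA \<open>a \<in> A\<close> wT xT by auto
    have xne: "x \<noteq> a" "x \<noteq> b" "x \<noteq> c" using N_irrefl[of x] bc(1) by auto
    have wa: "w \<in> N a" using a SN N_sym by auto
    have Na: "N a = {x,b,c,w}"
      by (rule nbr4) (use bc wa a4 wne xne in auto)
    obtain p q where "p \<in> S" "q \<in> S" "p \<noteq> q" "p \<in> N a" "q \<in> N a"
      by (rule local_cycle_set_nbrs[OF S a]) (rule that)
    moreover have "p \<noteq> w" "q \<noteq> w" "p \<noteq> x" "q \<noteq> x"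
      using calculation SN N_irrefl[of w] wT xT by auto
    ultimately have "b \<in> N w" "c \<in> N w" using Na SN by auto
    then have wbc: "w \<in> N b" "w \<in> N c" using N_sym by auto
    have sep: False
      if "card (N y) \<le> 4" "N x = {a,y,z}" "N a = {x,y,z,w}" "{x,a,z,w} \<subseteq> N y"
        "a \<noteq> y" "a \<noteq> z" "y \<noteq> z" "x \<noteq> y" "x \<noteq> z" "w \<noteq> y" "w \<noteq> z" "y \<in> V" "z \<in> V" for y z
    proof -
      have "card {x,a,z,w} = 4" using that xne wne by auto
      then have Ny: "{x,a,z,w} = N y" using that by (intro card_seteq) auto
      show False
      proof (rule no_small_separation[of "{x,a,y}" z w])
        fix u assume "u \<in> {x,a,y}"
        then show "N u \<subseteq> {x,a,y} \<union> {z,w}" using that(2,3) Ny[symmetric] by fastforce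
      qed (use that xT T_subset aV wT wne xne in \<open>auto simp: card_insert_if\<close>)
    qed
    have "5 \<le> card (N b)"
    proof (rule ccontr)
      assume "\<not> ?thesis"
      then show False using bc wbc xne wne Na by (intro sep[of b c]) auto
    qed
    moreover have "5 \<le> card (N c)"
    proof (rule ccontr)
      assume "\<not> ?thesis"
      then show False using bc wbc xne wne Na by (intro sep[of c b]) auto
    qed
    ultimately have "{b,c} \<subseteq> {z \<in> A. 5 \<le> card (N z)}" using bcA by auto
    then have "card {b,c} \<le> 1" using Z card_mono[of "{z \<in> A. 5 \<le> card (N z)}" "{b,c}"] by simp
    then show False using bc by simp
  qed
  then show "a \<in> (R - {w}) \<union> {z \<in> A. 5 \<le> card (N z)}"
    using aV by (auto simp: R_def)
qed

text \<open>Some \<open>w\<close> in \<open>R\<close> has a neighbour outside \<open>R\<close>. Its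
  other three neighbours form the local cycle \<open>S\<close>, so \<open>w\<close> and
  \<open>S\<close> span a \<open>K\<^sub>4\<close> in which each vertex of \<open>S\<close> has one
  edge to spare. At most two vertices of \<open>R\<close> remain, and their local cycles must use
  spare edges. Two vertices would need four of them; a single one would take all three and separate
  \<open>S\<close> together with \<open>w\<close>.\<close>

lemma four_regular_R:
  assumes deg: "\<And>w. w \<in> R \<Longrightarrow> card (N w) = 4"
    and loc: "\<And>w S. w \<in> R \<Longrightarrow> local_cycle_set w S \<Longrightarrow> S \<subseteq> R - {w}"
    and R: "R \<noteq> {}" "card R \<le> 6"
  shows "card R = 4"
proof -
  have RV: "R \<subseteq> V" by (auto simp: R_def)
  have "\<exists>w\<in>R. \<not> N w \<subseteq> R"
  proof (rule ccontr)
    assume "\<not> ?thesis"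
    then have "R = V - {}" using RV R by (intro three_connected) auto
    then show False using R card_V by simp
  qed
  then obtain w where w: "w \<in> R" "\<not> N w \<subseteq> R" by auto
  obtain S where S: "local_cycle_set w S" using w RV local_cycle_setE by blast
  have SR: "S \<subseteq> R - {w}" using loc w S by blast
  have SN: "S \<subseteq> N w" using S local_cycle_set_subset by blast
  have "S \<subset> N w" using SN SR w by auto
  then have "card S < 4" using deg[OF w(1)] psubset_card_mono[OF finite_N, of S w] by simp
  then have S3: "card S = 3" using local_cycle_set_card[OF S] by simp
  have finS: "finite S" using S local_cycle_set_finite by blast
  have clique: "insert w (S - {y}) \<subseteq> N y" if "y \<in> S" for y
    using local_cycle_set_card3[OF S S3 that] SN N_sym that by blast
  have one: "card (N y - insert w S) = 1" if "y \<in> S" for y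
  proof -
    have yR: "y \<in> R" using that SR by auto
    have "N y - insert w S = N y - insert w (S - {y})" using N_irrefl[of y] by auto
    also have "card \<dots> = card (N y) - card (insert w (S - {y}))"
      using clique[OF that] finS by (intro card_Diff_subset) auto
    also have "card (insert w (S - {y})) = 3"
      using that SR finS S3 by (subst card_insert_disjoint) auto
    finally show ?thesis using deg[OF yR] by simp
  qed
  define Q where "Q = R - insert w S"
  have "card (insert w S) = 4" using S3 SR finS by (subst card_insert_disjoint) auto
  then have cQ: "card R = card Q + 4"
    using SR w(1) finS card_Diff_subset[of "insert w S" R] card_mono[of R "insert w S"]
    by (simp add: Q_def subset_Diff_insert subset_insert_iff)
  have "Q = {}"
  proof (rule ccontr)
    assume "Q \<noteq> {}"
    have finQ: "finite Q" by (simp add: Q_def)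
    have nbrs: "4 - card Q \<le> card (N u \<inter> S)" if u: "u \<in> Q" for u
    proof -
      have uR: "u \<in> R" "u \<noteq> w" "u \<notin> S" using u by (auto simp: Q_def)
      obtain U where U: "local_cycle_set u U" using uR RV local_cycle_setE by blast
      have UR: "U \<subseteq> R - {u}" using loc uR(1) U by blast
      have UN: "U \<subseteq> N u" using U local_cycle_set_subset by blast
      \<comment> \<open>The fourth neighbour of \<open>w\<close> lies outside \<open>R\<close>,
        hence outside \<open>Q\<close>.\<close>
      have "w \<notin> N u"
      proof
        assume "w \<in> N u"
        then have "insert u S \<subseteq> N w" using N_sym SN by auto
        moreover have "card (insert u S) = 4" using uR finS S3 by simp
        ultimately have "insert u S = N w" using deg[OF w(1)] by (intro card_subset_eq) auto
        then show False using SR uR w by auto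
      qed
      then have "U \<subseteq> (N u \<inter> S) \<union> (Q - {u})" using UR UN by (auto simp: Q_def)
      then have "card U \<le> card ((N u \<inter> S) \<union> (Q - {u}))" using finQ by (intro card_mono) auto
      also have "\<dots> \<le> card (N u \<inter> S) + card (Q - {u})" by (rule card_Un_le)
      finally show ?thesis
        using local_cycle_set_card[OF U] u finQ card_gt_0_iff[of Q] by auto
    qed
    have swap: "(\<Sum>u\<in>Q. card (N u \<inter> S)) = (\<Sum>y\<in>S. card (N y \<inter> Q))"
    proof -
      have "(\<Sum>u\<in>Q. card (N u \<inter> S)) = (\<Sum>u\<in>Q. \<Sum>y\<in>S. if y \<in> N u then 1 else 0)"
        using finS by (intro sum.cong) (auto simp: sum.If_cases Int_commute)
      also have "\<dots> = (\<Sum>y\<in>S. \<Sum>u\<in>Q. if u \<in> N y then 1 else 0)"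
        using N_sym by (subst sum.swap) (intro sum.cong, auto)
      also have "\<dots> = (\<Sum>y\<in>S. card (N y \<inter> Q))"
        using finQ by (intro sum.cong) (auto simp: sum.If_cases Int_commute)
      finally show ?thesis .
    qed
    have le1: "card (N y \<inter> Q) \<le> 1" if "y \<in> S" for y
    proof -
      have "card (N y \<inter> Q) \<le> card (N y - insert w S)" by (intro card_mono) (auto simp: Q_def)
      then show ?thesis using one[OF that] by simp
    qed
    have "card Q * (4 - card Q) \<le> (\<Sum>u\<in>Q. card (N u \<inter> S))"
      using nbrs sum_bounded_below[of Q "4 - card Q" "\<lambda>u. card (N u \<inter> S)"] by simp
    also have "\<dots> \<le> card S * 1"
      unfolding swap using le1 sum_bounded_above[of S "\<lambda>y. card (N y \<inter> Q)" 1] by simp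
    finally have "card Q * (4 - card Q) \<le> 3" using S3 by simp
    moreover have "card Q \<noteq> 0" using \<open>Q \<noteq> {}\<close> finQ by simp
    moreover have "card Q \<le> 2" using cQ R by simp
    ultimately have "card Q = 1" by (cases "card Q = 2") auto
    then obtain u where u: "Q = {u}" by (auto simp: card_1_singleton_iff)
    have "card S \<le> card (N u \<inter> S)" using nbrs[of u] u S3 by simp
    then have "S \<subseteq> N u" using card_seteq[of S "N u \<inter> S"] finS by auto
    have uS: "u \<notin> insert w S" using u by (auto simp: Q_def)
    have NS: "N y \<subseteq> S \<union> {w,u}" if "y \<in> S" for y
    proof -
      have "u \<in> N y - insert w S" using \<open>S \<subseteq> N u\<close> that N_sym uS by auto
      then have "N y - insert w S = {u}" using one[OF that] by (metis card_1_singletonE singletonD)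
      then show ?thesis by auto
    qed
    show False
      by (rule no_small_separation[of S w u])
        (use NS S3 SR RV w u uS in \<open>auto simp: Q_def\<close>)
  qed
  then show ?thesis using cQ by simp
qed

text \<open>With \<open>t\<close> counting the neighbours in \<open>T\<close>, \<open>E\<close> the total excess of the degrees over four, and
  \<open>E' = (\<Sum>a\<in>A. t a - 1)\<close>, the defect is \<open>card R + 4 * E - E'\<close>, and \<open>E' \<le> E\<close>. So a small defect leaves
  only the cases \<open>E' = 0, E \<le> 1\<close> and \<open>E' = E \<le> 2\<close>.\<close>
lemma size_defect:
  assumes m: "2 * m = (\<Sum>x\<in>V. card (N x))"
  shows "15 * card V \<le> 8 * m" "8 * m - 15 * card V \<notin> {1,2,3,5,6}"
proof -
  define D where "D = 8 * int m - 15 * int (card V)"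
  have "D = 0 \<or> D = 4 \<or> 6 < D"
  proof (cases "\<exists>a\<in>V. N a \<inter> T \<noteq> {} \<and> card (N a - T) < 3")
    case True
    then have "6 * card V - 12 \<le> 2 * m" using few_outer_nbrs_size m by auto
    \<comment> \<open>The defect is at least \<open>9 * card V - 48\<close>, thus at least
      24.\<close>
    then have "24 * int (card V) - 48 \<le> 8 * int m" using card_V by linarith
    then have "6 < D" using card_V by (simp add: D_def)
    then show ?thesis by simp
  next
    case False
    define d where "d x = int (card (N x))" for x
    define t where "t x = int (card (N x \<inter> T))" for x
    define E where "E = (\<Sum>x\<in>A. d x - 4) + (\<Sum>x\<in>R. d x - 4)"
    define E' where "E' = (\<Sum>x\<in>A. t x - 1)"
    have d_split: "d x = t x + int (card (N x - T))" for x
      using card_Int_Diff[of "N x" T] by (simp add: d_def t_def)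
    have tA: "1 \<le> t a" "t a - 1 \<le> d a - 4" if "a \<in> A" for a
    proof -
      have "card (N a \<inter> T) \<noteq> 0" using that A_iff[of a] by simp
      then show "1 \<le> t a" by (simp add: t_def Suc_le_eq card_gt_0_iff)
      have "3 \<le> card (N a - T)" using False that A_iff A_subset by (meson not_less subsetD)
      then show "t a - 1 \<le> d a - 4" using d_split[of a] by simp
    qed
    have tA0: "0 \<le> t a - 1" if "a \<in> A" for a using tA(1)[OF that] by simp
    have dR: "0 \<le> d x - 4" if "x \<in> R" for x
      using deg_ge_4[of x] that by (simp add: d_def R_def)
    have V: "V = T \<union> (A \<union> R)" using T_subset A_subset by (auto simp: R_def)
    have disj: "T \<inter> (A \<union> R) = {}" "A \<inter> R = {}" using A_T_disjoint by (auto simp: R_def)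
    have cV: "int (card V) = int (card T) + int (card A) + int (card R)"
      using arg_cong[OF V, of card] disj by (simp add: card_Un_disjoint)
    have "2 * int m = (\<Sum>x\<in>V. d x)" using m by (simp add: d_def flip: of_nat_sum of_nat_mult)
    also have "\<dots> = (\<Sum>x\<in>T. d x) + (\<Sum>x\<in>A. d x) + (\<Sum>x\<in>R. d x)"
      using arg_cong[OF V, of "sum d"] disj by (simp add: sum.union_disjoint)
    also have "(\<Sum>x\<in>T. d x) = 3 * int (card T)" by (simp add: d_def T_def)
    finally have m2: "2 * int m = 3 * int (card T) + 4 * int (card A) + 4 * int (card R) + E"
      by (simp add: E_def sum_subtractf)
    \<comment> \<open>Adjacent pairs between \<open>A\<close> and \<open>T\<close> are counted from
      both sides; all three neighbours of a vertex of \<open>T\<close> lie in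
      \<open>A\<close>.\<close>
    have "(\<Sum>x\<in>A. t x) = (\<Sum>x\<in>A. \<Sum>y\<in>T. if y \<in> N x then 1 else 0)"
      by (intro sum.cong) (auto simp: t_def sum.If_cases Int_commute)
    also have "\<dots> = (\<Sum>y\<in>T. \<Sum>x\<in>A. if x \<in> N y then 1 else 0)"
      using N_sym by (subst sum.swap) (intro sum.cong, auto)
    also have "\<dots> = (\<Sum>y\<in>T. d y)"
    proof (rule sum.cong[OF refl])
      fix y assume "y \<in> T"
      then have "A \<inter> N y = N y" by (auto simp: A_def)
      then show "(\<Sum>x\<in>A. if x \<in> N y then 1 else 0) = d y" by (simp add: sum.If_cases d_def)
    qed
    also have "\<dots> = 3 * int (card T)" by (simp add: d_def T_def)
    finally have E': "E' = 3 * int (card T) - int (card A)" by (simp add: E'_def sum_subtractf)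
    have D: "D = int (card R) + 4 * E - E'"
      using m2 cV E' unfolding D_def by linarith
    have ER: "0 \<le> (\<Sum>x\<in>R. d x - 4)" by (rule sum_nonneg) (rule dR)
    have EA: "E' \<le> (\<Sum>x\<in>A. d x - 4)" unfolding E'_def by (rule sum_mono) (rule tA(2))
    have E'0: "0 \<le> E'" unfolding E'_def by (rule sum_nonneg) (use tA0 in blast)
    have EE: "E' \<le> E" using ER EA by (simp add: E_def)
    show ?thesis
    proof (cases "E' = 0")
      case True
      have t1: "card (N a \<inter> T) = 1" if "a \<in> A" for a
      proof -
        have "(\<Sum>x\<in>A. t x - 1) = 0" using True by (simp add: E'_def)
        then have "t a - 1 = 0" using sum_nonneg_0[OF finite_A, of "\<lambda>x. t x - 1"] tA0 that by blast
        then show ?thesis using that by (simp add: t_def)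
      qed
      define Z where "Z = {z \<in> A. 5 \<le> card (N z)}"
      have finZ: "finite Z" by (simp add: Z_def)
      have dA: "0 \<le> d a - 4" if "a \<in> A" for a using tA[OF that] by simp
      have ZE: "int (card Z) \<le> E"
      proof -
        have "int (card Z) = (\<Sum>x\<in>Z. 1)" by simp
        also have "\<dots> \<le> (\<Sum>x\<in>Z. d x - 4)" by (rule sum_mono) (simp add: Z_def d_def)
        also have "\<dots> \<le> (\<Sum>x\<in>A. d x - 4)"
          by (rule sum_mono2) (use dA in \<open>auto simp: Z_def\<close>)
        finally show ?thesis using ER by (simp add: E_def)
      qed
      have loc: "S \<subseteq> (R - {w}) \<union> Z" if "w \<in> R" "local_cycle_set w S" "E \<le> 1" for w S
        unfolding Z_def using local_cycle_in_R[OF t1 _ that(1,2)] ZE that(3) by (simp add: Z_def)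
      show ?thesis
      proof (rule ccontr)
        assume "\<not> ?thesis"
        then have D6: "D \<le> 6" "D \<noteq> 0" "D \<noteq> 4" by auto
        have "R \<noteq> {}" using D D6 True EE by auto
        then obtain w where w: "w \<in> R" by auto
        then obtain S where S: "local_cycle_set w S" using local_cycle_setE by (auto simp: R_def)
        have E1: "E \<le> 1" using D D6 True EE by linarith
        \<comment> \<open>If \<open>E = 1\<close>, then \<open>D = card R + 4\<close> leaves at most
          two vertices in \<open>R\<close>. A local cycle at \<open>w\<close> would have at most one
          vertex in \<open>R\<close> and one in \<open>Z\<close>, but needs three.\<close>
        have "card S \<le> card ((R - {w}) \<union> Z)"
          using loc[OF w S E1] finZ by (intro card_mono) auto
        also have "\<dots> \<le> card (R - {w}) + card Z" by (rule card_Un_le)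
        also have "\<dots> = card R - 1 + card Z" using w by simp
        finally have "3 \<le> card R - 1 + card Z" using local_cycle_set_card[OF S] by simp
        then have "E \<noteq> 1" using D D6 True ZE by linarith
        then have E0: "E = 0" using E1 EE True by simp
        then have "Z = {}" using ZE finZ by simp
        have "(\<Sum>x\<in>R. d x - 4) = 0"
          using E0 ER sum_nonneg[of A "\<lambda>x. d x - 4"] dA by (simp add: E_def)
        then have "d x - 4 = 0" if "x \<in> R" for x using sum_nonneg_0[OF finite_R, of "\<lambda>x. d x - 4"] dR that by blast
        then have "card R = 4"
          using loc E1 \<open>Z = {}\<close> \<open>R \<noteq> {}\<close> D6 D E0 True
          by (intro four_regular_R) (auto simp: d_def)
        then show False using D D6 E0 True by simp
      qed
    next
      case False
      show ?thesis
      proof (rule ccontr)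
        assume "\<not> ?thesis"
        then have D6: "D \<le> 6" "D \<noteq> 0" "D \<noteq> 4" by auto
        \<comment> \<open>If \<open>E \<ge> E' + 1\<close>, then
          \<open>D \<ge> 3 * E' + 4 \<ge> 7\<close>. If \<open>E = E'\<close>, then
          \<open>D \<ge> 3 * E'\<close>, so \<open>E' \<le> 2\<close>.\<close>
        have EE2: "E = E'" "E \<le> 2" using D D6 E'0 EE False by linarith+
        have eqA: "(\<Sum>x\<in>A. d x - 4) = (\<Sum>x\<in>A. t x - 1)" using EE2 EA ER by (simp add: E_def E'_def)
        have "(\<Sum>x\<in>A. (d x - 4) - (t x - 1)) = 0"
          unfolding sum_subtractf[of "\<lambda>x. d x - 4"] using eqA by simp
        moreover have "0 \<le> (d x - 4) - (t x - 1)" if "x \<in> A" for x using tA(2)[OF that] by simp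
        ultimately have eq0: "(d x - 4) - (t x - 1) = 0" if "x \<in> A" for x
          using sum_nonneg_0[OF finite_A, of "\<lambda>x. (d x - 4) - (t x - 1)"] that by blast
        have three: "card (N a - T) = 3" if "a \<in> A" for a
          using eq0[OF that] d_split[of a] by linarith
        have E'2: "(\<Sum>x\<in>A. t x - 1) \<le> 2" using EE2 by (simp add: E'_def)
        have "\<exists>a\<in>A. t a - 1 \<noteq> 0"
          using False sum.neutral[of A "\<lambda>x. t x - 1"] unfolding E'_def by blast
        then obtain a where "a \<in> A" "t a - 1 \<noteq> 0" by blast
        then have a: "a \<in> A" "2 \<le> t a" using tA0[of a] by simp_all
        have "\<exists>x x'. x \<in> N a \<inter> T \<and> x' \<in> N a \<inter> T \<and> x \<noteq> x'"
          using a(2) card_le_Suc0_iff_eq[of "N a \<inter> T"] by (auto simp: t_def)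
        then obtain x x' where x: "x \<in> T" "x' \<in> T" "x \<in> N a" "x' \<in> N a" "x \<noteq> x'" by blast
        have ax: "a \<in> N x" "a \<in> N x'" using x N_sym by auto
        have sub: "N y - {a} \<subseteq> N a - T" if "y \<in> {x,x'}" for y
          using that T_clique[of y a] T_indep[of y] x ax by auto
        have card2: "card (N y - {a}) = 2" if "y \<in> {x,x'}" for y
          using that x ax by (auto simp: T_def)
        \<comment> \<open>Two pairs in the three-element set \<open>N a - T\<close> meet: one shared
          vertex forces a second one.\<close>
        have "(N x - {a}) \<inter> (N x' - {a}) \<noteq> {}"
        proof
          assume "(N x - {a}) \<inter> (N x' - {a}) = {}"
          then have "card ((N x - {a}) \<union> (N x' - {a})) = 4"
            using card2 by (simp add: card_Un_disjoint)
          moreover have "card ((N x - {a}) \<union> (N x' - {a})) \<le> card (N a - T)"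
            using sub by (intro card_mono) auto
          ultimately show False using three[OF a(1)] by simp
        qed
        then obtain b where b: "b \<in> N x" "b \<in> N x'" "b \<noteq> a" by auto
        have bA: "b \<in> A" using b x by (auto simp: A_def)
        have xb: "x \<in> N b" "x' \<in> N b" using b N_sym by auto
        have "2 = card {x,x'}" using x by simp
        also have "\<dots> \<le> card (N b \<inter> T)" using xb x by (intro card_mono) auto
        finally have tb: "2 \<le> t b" by (simp add: t_def)
        have split: "(\<Sum>x\<in>A. t x - 1) = (t a - 1) + (t b - 1) + (\<Sum>x\<in>A - {a,b}. t x - 1)"
          using sum.subset_diff[of "{a,b}" A "\<lambda>x. t x - 1"] a bA b(3) by simp
        have rest: "0 \<le> (\<Sum>x\<in>A - {a,b}. t x - 1)"
          by (rule sum_nonneg) (use tA0 in blast)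
        \<comment> \<open>\<open>a\<close> and \<open>b\<close> exhaust the total of two, so no
          third vertex is shared. Hence the remaining neighbours \<open>c\<close> of
          \<open>x\<close> and \<open>c'\<close> of \<open>x'\<close> differ, and they separate
          \<open>{a,b,x,x'}\<close>.\<close>
        have ta2: "t a = 2" "t b = 2" "(\<Sum>x\<in>A - {a,b}. t x - 1) = 0"
          using split rest E'2 a(2) tb by linarith+
        have t1: "t c = 1" if "c \<in> A" "c \<noteq> a" "c \<noteq> b" for c
        proof -
          have "0 \<le> t x - 1" if "x \<in> A - {a,b}" for x using tA0 that by blast
          then have "t c - 1 = 0"
            using sum_nonneg_0[of "A - {a,b}" "\<lambda>x. t x - 1"] ta2(3) that by simp
          then show ?thesis by simp
        qed
        have "{x,x'} = N a \<inter> T" "{x,x'} = N b \<inter> T"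
          by (rule card_subset_eq; use x xb ta2 in \<open>simp add: t_def\<close>)+
        note NT = this[symmetric]
        obtain c where c: "N x = {a,b,c}" "a \<noteq> c" "b \<noteq> c" "c \<in> N a" "c \<in> N b" "b \<in> N a" "a \<in> N b" "c \<in> V" "x \<in> N c"
          by (rule T_two_nbrsE[OF x(1) ax(1) b(1) b(3)[symmetric]]) (rule that)
        obtain c' where c': "N x' = {a,b,c'}" "a \<noteq> c'" "b \<noteq> c'" "c' \<in> N a" "c' \<in> N b" "c' \<in> V" "x' \<in> N c'"
          by (rule T_two_nbrsE[OF x(2) ax(2) b(2) b(3)[symmetric]]) (rule that)
        have cT: "a \<notin> T" "b \<notin> T" "c \<notin> T" "c' \<notin> T"
          using T_indep[OF x(1)] T_indep[OF x(2)] c(1) c'(1) by auto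
        have "c \<noteq> c'"
        proof
          assume "c = c'"
          then have "{x,x'} \<subseteq> N c \<inter> T" using c c' x by auto
          then have "card {x,x'} \<le> card (N c \<inter> T)" by (intro card_mono) auto
          moreover have "c \<in> A" using c x by (auto simp: A_def)
          ultimately show False using t1[of c] c x by (simp add: t_def)
        qed
        have "{b,c,c'} = N a - T" "{a,c,c'} = N b - T"
          by (rule card_subset_eq;
              use three[OF a(1)] three[OF bA] c c' cT \<open>c \<noteq> c'\<close> b(3) N_sym[of b a] in auto)+
        then have N_eq: "N a = {x,x',b,c,c'}" "N b = {x,x',a,c,c'}" using NT by auto
        show False
          by (rule no_small_separation[of "{a,b,x,x'}" c c'])
            (use N_eq c c' cT x a bA A_subset T_subset in \<open>auto simp: card_insert_if\<close>)
      qed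
    qed
  qed
  then show "15 * card V \<le> 8 * m" "8 * m - 15 * card V \<notin> {1,2,3,5,6}"
    unfolding D_def by auto
qed

text \<open>The defect \<open>D\<close> is congruent to \<open>j\<close> modulo 8 and takes below 8
  only the values 0, 4, 7. So \<open>D \<ge> j\<close> for these \<open>j\<close> and
  \<open>D \<ge> j + 8\<close> for all others. In \<open>8 * t = 15 * j + D\<close> the two bounds
  give \<open>2 * j\<close> and \<open>2 * j + 1\<close>.\<close>

theorem extremal_f_le:
  assumes m: "2 * m = (\<Sum>x\<in>V. card (N x))"
  shows "extremal_f (card V) \<le> m"
proof -
  define k j D where "k = card V div 8" and "j = card V mod 8" and "D = 8 * m - 15 * card V"
  have V: "card V = 8 * k + j" by (simp add: k_def j_def)
  have "D \<notin> {1,2,3,5,6}" using size_defect(2)[OF m] by (simp add: D_def)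
  then have D: "D = 0 \<or> D = 4 \<or> 7 \<le> D" by auto
  have eq: "8 * m = 120 * k + 15 * j + D" using size_defect(1)[OF m] by (simp add: D_def V)
  have "j < 8" by (simp add: j_def)
  have f: "extremal_f (card V) = (if j \<in> {0, 4, 7} then 15 * k + 2 * j else 15 * k + 2 * j + 1)"
    using \<open>j < 8\<close> by (simp add: extremal_f_def V)
  have "15 * k \<le> m" using eq by linarith
  then obtain t where t: "m = 15 * k + t" using le_Suc_ex by blast
  then have "8 * t = 15 * j + D" using eq by simp
  then have "t \<ge> (if j \<in> {0, 4, 7} then 2 * j else 2 * j + 1)"
    using D \<open>j < 8\<close> by (auto split: if_splits) presburger+
  then show ?thesis unfolding f t by auto
qed

end

section \<open>Finite graphs as instances of the counting setting\<close>

lemma (in graph) neighborhood_iff: "y \<in> neighborhood G x \<longleftrightarrow> x \<rightarrow>\<^bsub>G\<^esub> y"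
  by (simp add: neighborhood_def)

lemma (in graph) neighborhood_subset: "neighborhood G x \<subseteq> verts G"
  using adj_in_verts by (auto simp: neighborhood_def)

lemma (in graph) local_cycle_graphI:
  assumes conn: "k_connected 3 G" and loc: "locally_nonforesty G" and n: "8 \<le> graph_order G"
  shows "local_cycle_graph (verts G) (neighborhood G)"
proof
  show "finite (verts G)" by simp
  show "neighborhood G x \<subseteq> verts G" for x by (rule neighborhood_subset)
  show "x \<in> neighborhood G y" if "y \<in> neighborhood G x" for x y
    using that graph_symmetric by (simp add: neighborhood_iff)
  show "x \<notin> neighborhood G x" for x
    using adj_not_same by (auto simp: neighborhood_iff)
  show "8 \<le> card (verts G)" using n by (simp add: graph_order_def)
next
  fix X S
  assume X: "X \<subseteq> verts G" "card X < 3" and S: "S \<subseteq> verts G - X" "S \<noteq> {}"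
    and closed: "\<And>u. u \<in> S \<Longrightarrow> neighborhood G u \<subseteq> S \<union> X"
  have "connected (G \<restriction> (verts G - X))" using conn X by (auto simp: k_connected_def)
  then have C: "conn_on (verts G - X) (\<lambda>u v. u \<rightarrow>\<^bsub>G\<^esub> v)"
    using connected_induce_iff[OF sym_arcs] by auto
  obtain s where s: "s \<in> S" using S by auto
  have "z \<in> S" if z: "z \<in> verts G - X" for z
  proof -
    have "(s \<in> S) = (z \<in> S)"
    proof (rule conn_onD[OF C _ _ z, where P = "\<lambda>w. w \<in> S"])
      fix u v assume uv: "u \<in> verts G - X" "v \<in> verts G - X" "u \<rightarrow>\<^bsub>G\<^esub> v"
      then have "v \<in> neighborhood G u" "u \<in> neighborhood G v"
        using graph_symmetric by (auto simp: neighborhood_iff)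
      then show "(u \<in> S) = (v \<in> S)" using closed[of u] closed[of v] uv by blast
    qed (use s S in auto)
    then show ?thesis using s by simp
  qed
  then show "S = verts G - X" using S by auto
next
  fix x assume "x \<in> verts G"
  then have "contains_cycle (G \<restriction> neighborhood G x)" using loc by (simp add: locally_nonforesty_def)
  then obtain S where "S \<subseteq> neighborhood G x" "S \<noteq> {}"
    "\<And>y. y \<in> S \<Longrightarrow> \<exists>a\<in>S. \<exists>b\<in>S. a \<noteq> b \<and> y \<rightarrow>\<^bsub>G\<^esub> a \<and> y \<rightarrow>\<^bsub>G\<^esub> b"
    using contains_cycle_imp_min_degree_two[OF sym_arcs neighborhood_subset] by metis
  then show "\<exists>S\<subseteq>neighborhood G x. S \<noteq> {} \<and>
      (\<forall>y\<in>S. \<exists>a\<in>S. \<exists>b\<in>S. a \<noteq> b \<and> a \<in> neighborhood G y \<and> b \<in> neighborhood G y)"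
    unfolding neighborhood_iff by blast
qed

lemma (in graph) two_graph_size_eq_sum_degrees:
  "2 * graph_size G = (\<Sum>x\<in>verts G. card (neighborhood G x))"
proof -
  have "arcs_ends G = Sigma (verts G) (neighborhood G)"
    using adj_in_verts by (auto simp: neighborhood_def)
  moreover have "finite (neighborhood G x)" for x
    using neighborhood_subset finite_verts finite_subset by blast
  ultimately show ?thesis by (simp add: two_graph_size_eq_card_arcs_ends card_SigmaI)
qed

theorem (in graph) extremal_f_le_graph_size:
  assumes "k_connected 3 G" "locally_nonforesty G" "8 \<le> graph_order G"
  shows "extremal_f (graph_order G) \<le> graph_size G"
proof -
  interpret local_cycle_graph "verts G" "neighborhood G"
    using assms by (rule local_cycle_graphI)
  show ?thesis
    unfolding graph_order_def by (rule extremal_f_le[OF two_graph_size_eq_sum_degrees])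
qed

section \<open>Extending a graph by two complete graphs\<close>

definition digraph_of :: "nat \<Rightarrow> (nat \<times> nat) set \<Rightarrow> (nat, nat \<times> nat) pre_digraph" where
  "digraph_of n r = \<lparr>verts = {..<n}, arcs = r, tail = fst, head = snd\<rparr>"

lemma arcs_ends_digraph_of [simp]: "arcs_ends (digraph_of n r) = r"
  by (auto simp: arcs_ends_conv digraph_of_def)

text \<open>The triangle is oriented cyclically. For symmetric irreflexive \<open>s\<close> the six
  pairs span a complete graph on four vertices, with distinctness supplied by irreflexivity.\<close>

definition in_K4 :: "('a \<times> 'a) set \<Rightarrow> 'a \<Rightarrow> bool" where
  "in_K4 s y \<longleftrightarrow> (\<exists>a b c. {(y,a), (y,b), (y,c), (a,b), (b,c), (c,a)} \<subseteq> s)"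

text \<open>The two disjoint edges \<open>uv\<close> and \<open>u'v'\<close> are those at which the graph will be extended, so
  the local cycles must avoid them.\<close>
definition extendable :: "nat \<Rightarrow> nat \<Rightarrow> (nat \<times> nat) set \<Rightarrow> bool" where
  "extendable n m r \<longleftrightarrow> r \<subseteq> {..<n} \<times> {..<n} \<and> irrefl r \<and> sym r \<and> card r = 2 * m \<and> 3 < n \<and>
     (\<forall>X\<subseteq>{..<n}. card X < 3 \<longrightarrow> conn_on ({..<n} - X) (\<lambda>u v. (u,v) \<in> r)) \<and>
     (\<exists>u v u' v'. distinct [u,v,u',v'] \<and> (u,v) \<in> r \<and> (u',v') \<in> r \<and>
        (\<forall>y<n. in_K4 (r - {(u,v),(v,u),(u',v'),(v',u')}) y))"

lemma extendable_realization:
  assumes "extendable n m r"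
  shows "graph (digraph_of n r)" "k_connected 3 (digraph_of n r)"
    "locally_nonforesty (digraph_of n r)" "graph_order (digraph_of n r) = n"
    "graph_size (digraph_of n r) = m"
proof -
  let ?G = "digraph_of n r"
  have r: "r \<subseteq> {..<n} \<times> {..<n}" "irrefl r" "sym r" "card r = 2 * m" "3 < n"
    using assms by (auto simp: extendable_def)
  have fin: "finite r" using r(1) finite_subset by blast
  show G: "graph ?G"
  proof
    show "symmetric ?G" using r by (simp add: symmetric_def)
  qed (use r fin in \<open>auto simp: digraph_of_def irrefl_def arc_to_ends_def\<close>)
  then interpret graph ?G .
  have verts: "verts ?G = {..<n}" by (simp add: digraph_of_def)
  show "graph_order ?G = n" by (simp add: graph_order_def verts)
  show "graph_size ?G = m" using two_graph_size_eq_card_arcs_ends r(4) by simp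
  show "k_connected 3 ?G"
    unfolding k_connected_def
  proof (intro conjI allI impI)
    show "3 < graph_order ?G" using r by (simp add: graph_order_def verts)
    fix X assume X: "X \<subseteq> verts ?G" "card X < 3"
    have "verts ?G - X \<noteq> {}"
      using X r(5) card_mono[of X "{..<n}"] finite_subset[OF X(1)] by (auto simp: verts)
    moreover have "conn_on (verts ?G - X) (\<lambda>u v. (u,v) \<in> r)"
      using assms X unfolding extendable_def verts by blast
    ultimately show "connected (?G \<restriction> (verts ?G - X))"
      using connected_induce_iff[OF sym_arcs, of "verts ?G - X"] by simp
  qed
  show "locally_nonforesty ?G"
    unfolding locally_nonforesty_def
  proof
    fix y assume "y \<in> verts ?G"
    then have "\<exists>s\<subseteq>r. in_K4 s y" using assms unfolding extendable_def verts by (elim conjE exE) auto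
    then obtain a b c where abc: "{(y,a), (y,b), (y,c), (a,b), (b,c), (c,a)} \<subseteq> r"
      unfolding in_K4_def by (elim exE conjE) auto
    have ne: "a \<noteq> b" "b \<noteq> c" "a \<noteq> c" using abc r(2) by (auto simp: irrefl_def)
    show "contains_cycle (?G \<restriction> neighborhood ?G y)"
      by (rule contains_cycle_triangle[of _ _ a b c])
        (use abc r(1) ne in \<open>auto simp: neighborhood_def verts\<close>)
  qed
qed

section \<open>Connectivity of the extended graph\<close>

lemma small_set_misses_third:
  assumes "card X < 3" "finite X" "X \<inter> A \<noteq> {}" "X \<inter> B \<noteq> {}" "A \<inter> B = {}" "A \<inter> C = {}" "B \<inter> C = {}"
  shows "X \<inter> C = {}"
proof (rule ccontr)
  assume "X \<inter> C \<noteq> {}"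
  then obtain p q r where pqr: "p \<in> X \<inter> A" "q \<in> X \<inter> B" "r \<in> X \<inter> C" using assms by blast
  then have "p \<noteq> q" "p \<noteq> r" "q \<noteq> r" using assms by blast+
  then have "card {p,q,r} = 3" by simp
  moreover have "card {p,q,r} \<le> card X" using assms pqr by (intro card_mono) auto
  ultimately show False using assms by simp
qed

text \<open>Connectivity survives the deletion of edges as long as deleting, in addition, one endpoint
  of each of them leaves few enough deleted vertices.\<close>
lemma constant_despite_deleted_edges:
  fixes P :: "'a \<Rightarrow> bool"
  assumes conn: "conn_on (W - U) E"
    and inv: "\<And>y z. y \<in> W - U \<Longrightarrow> z \<in> W - U \<Longrightarrow> E y z \<Longrightarrow> P y = P z"
    and nbr: "\<And>u. u \<in> U \<inter> W \<Longrightarrow> \<exists>z\<in>W - U. P u = P z"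
    and yz: "y \<in> W" "z \<in> W"
  shows "P y = P z"
proof -
  have "\<exists>y'\<in>W - U. P y = P y'" "\<exists>z'\<in>W - U. P z = P z'"
    using nbr yz by blast+
  then obtain y' z' where "y' \<in> W - U" "z' \<in> W - U" "P y = P y'" "P z = P z'" by blast
  then show ?thesis using conn_onD[OF conn inv] by simp
qed

lemma three_nbrs_avoid_two:
  assumes "p \<noteq> q" "q \<noteq> t" "p \<noteq> t" obtains z where "z \<in> {p,q,t}" "z \<noteq> a" "z \<noteq> b"
  using assms by (metis insertCI)

text \<open>If \<open>a\<close> and \<open>b\<close> survive, the path \<open>u\<close>,
  \<open>a\<close>, \<open>b\<close>, \<open>v\<close> replaces the deleted edge \<open>uv\<close>.
  Otherwise \<open>X\<close> spends a vertex on this copy of \<open>K\<^sub>4\<close>, and the old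
  graph stays connected even when \<open>u\<close> is deleted as well, so that \<open>uv\<close> no
  longer matters. Surviving new vertices reach old ones because three disjoint paths lead there and
  \<open>X\<close> meets at most two of them.\<close>

lemma conn_on_extension:
  assumes conn: "\<And>X. X \<subseteq> V \<Longrightarrow> card X < 3 \<Longrightarrow> conn_on (V - X) (\<lambda>u v. (u,v) \<in> r)"
    and finV: "finite V"
    and nbrs: "\<And>y. y \<in> V \<Longrightarrow> \<exists>p q t. {p,q,t} \<subseteq> V - {y} \<and> p \<noteq> q \<and> q \<noteq> t \<and> p \<noteq> t \<and>
      {(y,p),(y,q),(y,t)} \<subseteq> s"
    and s: "r \<subseteq> s \<union> {(u,v),(v,u),(u',v'),(v',u')}" "s \<subseteq> r'"
    and old: "{u,v,u',v'} \<subseteq> V" "distinct [u,v,u',v']"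
    and new: "distinct [x,a,b,c,x',a',b',c']" "{x,a,b,c,x',a',b',c'} \<inter> V = {}"
    and edges: "{(x,a),(x,b),(x,c),(a,b),(a,c),(b,c), (x',a'),(x',b'),(x',c'),(a',b'),(a',c'),(b',c'),
      (u,a),(v,b),(u',a'),(v',b'),(c,c')} \<subseteq> r'"
    and X: "X \<subseteq> V \<union> {x,a,b,c,x',a',b',c'}" "card X < 3"
  shows "conn_on (V \<union> {x,a,b,c,x',a',b',c'} - X) (\<lambda>u v. (u,v) \<in> r')"
  unfolding conn_on_def
proof (intro allI impI)
  fix P :: "'a \<Rightarrow> bool"
  let ?W = "V \<union> {x,a,b,c,x',a',b',c'} - X"
  assume inv: "\<forall>y\<in>?W. \<forall>z\<in>?W. (y,z) \<in> r' \<longrightarrow> P y = P z"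
  have finX: "finite X" using X(1) finV finite_subset by blast
  have XV: "X \<inter> V \<subseteq> V" "finite (X \<inter> V)" "card (X \<inter> V) < 3"
    using finX X(2) card_mono[OF finX, of "X \<inter> V"] by auto
  have sP: "P y = P z" if "(y,z) \<in> s" "y \<in> V - X" "z \<in> V - X" for y z
    using inv[rule_format, of y z] that s(2) by blast
  have e: "x \<notin> X \<Longrightarrow> a \<notin> X \<Longrightarrow> P x = P a" "x \<notin> X \<Longrightarrow> b \<notin> X \<Longrightarrow> P x = P b" "x \<notin> X \<Longrightarrow> c \<notin> X \<Longrightarrow> P x = P c"
    "a \<notin> X \<Longrightarrow> b \<notin> X \<Longrightarrow> P a = P b" "a \<notin> X \<Longrightarrow> c \<notin> X \<Longrightarrow> P a = P c" "b \<notin> X \<Longrightarrow> c \<notin> X \<Longrightarrow> P b = P c"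
    "x' \<notin> X \<Longrightarrow> a' \<notin> X \<Longrightarrow> P x' = P a'" "x' \<notin> X \<Longrightarrow> b' \<notin> X \<Longrightarrow> P x' = P b'"
    "x' \<notin> X \<Longrightarrow> c' \<notin> X \<Longrightarrow> P x' = P c'" "a' \<notin> X \<Longrightarrow> b' \<notin> X \<Longrightarrow> P a' = P b'"
    "a' \<notin> X \<Longrightarrow> c' \<notin> X \<Longrightarrow> P a' = P c'" "b' \<notin> X \<Longrightarrow> c' \<notin> X \<Longrightarrow> P b' = P c'"
    "u \<notin> X \<Longrightarrow> a \<notin> X \<Longrightarrow> P u = P a" "v \<notin> X \<Longrightarrow> b \<notin> X \<Longrightarrow> P v = P b"
    "u' \<notin> X \<Longrightarrow> a' \<notin> X \<Longrightarrow> P u' = P a'" "v' \<notin> X \<Longrightarrow> b' \<notin> X \<Longrightarrow> P v' = P b'"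
    "c \<notin> X \<Longrightarrow> c' \<notin> X \<Longrightarrow> P c = P c'"
    by (rule inv[rule_format]; use edges old in blast)+
  have clique: "P y = P z" if "y \<in> {x,a,b,c} - X" "z \<in> {x,a,b,c} - X" for y z
    using that e(1-6) by (elim DiffE insertE emptyE) simp_all
  have clique': "P y = P z" if "y \<in> {x',a',b',c'} - X" "z \<in> {x',a',b',c'} - X" for y z
    using that e(7-12) by (elim DiffE insertE emptyE) simp_all
  have sim: "P u = P v" if "{a,b} \<inter> X = {}" "u \<notin> X" "v \<notin> X"
    using that e(13)[of] e(14) e(4) by simp
  have sim': "P u' = P v'" if "{a',b'} \<inter> X = {}" "u' \<notin> X" "v' \<notin> X"
    using that e(15) e(16) e(10) by simp
  have two: "X \<inter> M = {}" if "X \<inter> A \<noteq> {}" "X \<inter> B \<noteq> {}" "A \<inter> B = {}" "A \<inter> M = {}" "B \<inter> M = {}" for A B M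
    using small_set_misses_third[OF X(2) finX that] .
  \<comment> \<open>Of the three neighbours in \<open>s\<close>, one remains after excluding
    \<open>t\<close>, the only old vertex that \<open>X\<close> may contain, and the other removed
    endpoint \<open>w'\<close>.\<close>
  have nbr: "\<exists>z\<in>V - X - {w,w'}. P w = P z" if w: "w \<in> V - X" and t: "X \<inter> V \<subseteq> {t}" for w w' t
  proof -
    obtain p q k where pqk: "{p,q,k} \<subseteq> V - {w}" "p \<noteq> q" "q \<noteq> k" "p \<noteq> k" "{(w,p),(w,q),(w,k)} \<subseteq> s"
      using nbrs[of w] w by auto
    obtain z where z: "z \<in> {p,q,k}" "z \<noteq> w'" "z \<noteq> t"
      by (rule three_nbrs_avoid_two[OF pqk(2-4), of w' t]) (rule that)
    have zV: "z \<in> V - X - {w,w'}" using z pqk(1) t by blast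
    have "(w,z) \<in> s" using z(1) pqk(5) by blast
    then have "P w = P z" using w zV by (intro sP) auto
    then show ?thesis using zV by blast
  qed
  have single: "\<exists>t. X \<inter> V \<subseteq> {t}" if M: "M \<inter> X \<noteq> {}" "M \<inter> V = {}" for M
  proof -
    obtain p where p: "p \<in> X" "p \<notin> V" using M by blast
    have "card (X \<inter> V) \<le> card (X - {p})" using p finX by (intro card_mono) auto
    then have "card (X \<inter> V) \<le> Suc 0" using p finX X(2) by simp
    then show ?thesis using card_le_Suc0_iff_eq[OF XV(2)] by blast
  qed
  have del: "conn_on (V - X - U) (\<lambda>u v. (u,v) \<in> r)" if "U \<subseteq> V" "card ((X \<inter> V) \<union> U) < 3" for U
  proof -
    have "V - X - U = V - ((X \<inter> V) \<union> U)" by blast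
    then show ?thesis using conn[of "(X \<inter> V) \<union> U"] that by simp
  qed
  have del1: "conn_on (V - X - {w}) (\<lambda>u v. (u,v) \<in> r)" if "X \<inter> V \<subseteq> {t}" "w \<in> V" for w t
  proof (rule del)
    have "card (X \<inter> V \<union> {w}) \<le> card {t,w}" using that by (intro card_mono) auto
    also have "\<dots> < 3" by (simp add: card_insert_if)
    finally show "card (X \<inter> V \<union> {w}) < 3" .
  qed (use that in auto)
  have oldP: "P y = P z" if yz: "y \<in> V - X" "z \<in> V - X" for y z
  proof -
    consider (both) "{a,b} \<inter> X = {}" "{a',b'} \<inter> X = {}"
      | (left) "{a,b} \<inter> X \<noteq> {}" "{a',b'} \<inter> X = {}"
      | (right) "{a,b} \<inter> X = {}" "{a',b'} \<inter> X \<noteq> {}"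
      | (none) "{a,b} \<inter> X \<noteq> {}" "{a',b'} \<inter> X \<noteq> {}" by blast
    then show ?thesis
    proof cases
      case both
      have "conn_on (V - (X \<inter> V)) (\<lambda>u v. (u,v) \<in> r)" using conn XV by blast
      then have C: "conn_on (V - X) (\<lambda>u v. (u,v) \<in> r)" by (simp add: Diff_Int)
      show ?thesis
      proof (rule conn_onD[OF C _ yz])
        fix y z assume "y \<in> V - X" "z \<in> V - X" "(y,z) \<in> r"
        then show "P y = P z" using s(1) sP[of y z] sim[OF both(1)] sim'[OF both(2)] by blast
      qed
    next
      case left
      obtain t where t: "X \<inter> V \<subseteq> {t}" using single[OF left(1)] new(2) by blast
      have u: "u \<in> V" using old by simp
      show ?thesis
      proof (rule constant_despite_deleted_edges[OF del1[OF t u] _ _ yz])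
        fix y z assume "y \<in> V - X - {u}" "z \<in> V - X - {u}" "(y,z) \<in> r"
        then show "P y = P z" using s(1) sP[of y z] sim'[OF left(2)] by blast
      next
        fix w assume "w \<in> {u} \<inter> (V - X)"
        then show "\<exists>z\<in>V - X - {u}. P w = P z" using nbr[OF _ t, of u u] by auto
      qed
    next
      case right
      obtain t where t: "X \<inter> V \<subseteq> {t}" using single[OF right(2)] new(2) by blast
      have u: "u' \<in> V" using old by simp
      show ?thesis
      proof (rule constant_despite_deleted_edges[OF del1[OF t u] _ _ yz])
        fix y z assume "y \<in> V - X - {u'}" "z \<in> V - X - {u'}" "(y,z) \<in> r"
        then show "P y = P z" using s(1) sP[of y z] sim[OF right(1)] by blast
      next
        fix w assume "w \<in> {u'} \<inter> (V - X)"
        then show "\<exists>z\<in>V - X - {u'}. P w = P z" using nbr[OF _ t, of u' u'] by auto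
      qed
    next
      \<comment> \<open>\<open>X\<close> has a vertex in each new copy and therefore no old one, so
        both \<open>u\<close> and \<open>u'\<close> may be deleted.\<close>
      case none
      have XV0: "X \<inter> V = {}"
        by (rule two[of "{a,b}" "{a',b'}"]) (use none new in auto)
      show ?thesis
      proof (rule constant_despite_deleted_edges[OF _ _ _ yz])
        show "conn_on (V - X - {u,u'}) (\<lambda>u v. (u,v) \<in> r)"
          by (rule del) (use XV0 old in \<open>auto simp: card_insert_if\<close>)
        fix y z assume "y \<in> V - X - {u,u'}" "z \<in> V - X - {u,u'}" "(y,z) \<in> r"
        then show "P y = P z" using s(1) sP[of y z] by blast
      next
        fix w assume "w \<in> {u,u'} \<inter> (V - X)"
        then consider "w = u" "w \<in> V - X" | "w = u'" "w \<in> V - X" by blast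
        then show "\<exists>z\<in>V - X - {u,u'}. P w = P z"
        proof cases
          case 1
          then show ?thesis using nbr[of u u u'] XV0 by simp
        next
          case 2
          then show ?thesis using nbr[of u' u' u] XV0 by (simp add: insert_commute)
        qed
      qed
    qed
  qed
  have attach: "\<exists>z\<in>V - X. P y = P z" if y: "y \<in> {x,a,b,c} - X" for y
  proof -
    \<comment> \<open>Two of the disjoint paths leave through \<open>u\<close> and \<open>v\<close>;
      the third crosses the edge \<open>cc'\<close> and passes through the other copy.\<close>
    have "{a,u} \<inter> {b,v} = {}" "{a,u} \<inter> {c,c',a',u'} = {}" "{b,v} \<inter> {c,c',a',u'} = {}"
      using old new by auto
    then consider "X \<inter> {a,u} = {}" | "X \<inter> {b,v} = {}" | "X \<inter> {c,c',a',u'} = {}"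
      using two[of "{a,u}" "{b,v}" "{c,c',a',u'}"] by blast
    then show ?thesis
    proof cases
      case 1
      then have "P y = P a" "P u = P a" using clique[OF y, of a] e(13) by simp_all
      then show ?thesis using 1 old by (intro bexI[of _ u]) auto
    next
      case 2
      then have "P y = P b" "P v = P b" using clique[OF y, of b] e(14) by simp_all
      then show ?thesis using 2 old by (intro bexI[of _ v]) auto
    next
      case 3
      then have "P y = P c" "P c = P c'" "P a' = P c'" "P u' = P a'"
        using clique[OF y, of c] e(11,15,17) by simp_all
      then show ?thesis using 3 old by (intro bexI[of _ u']) auto
    qed
  qed
  have attach': "\<exists>z\<in>V - X. P y = P z" if y: "y \<in> {x',a',b',c'} - X" for y
  proof -
    have "{a',u'} \<inter> {b',v'} = {}" "{a',u'} \<inter> {c,c',a,u} = {}" "{b',v'} \<inter> {c,c',a,u} = {}"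
      using old new by auto
    then consider "X \<inter> {a',u'} = {}" | "X \<inter> {b',v'} = {}" | "X \<inter> {c,c',a,u} = {}"
      using two[of "{a',u'}" "{b',v'}" "{c,c',a,u}"] by blast
    then show ?thesis
    proof cases
      case 1
      then have "P y = P a'" "P u' = P a'" using clique'[OF y, of a'] e(15) by simp_all
      then show ?thesis using 1 old by (intro bexI[of _ u']) auto
    next
      case 2
      then have "P y = P b'" "P v' = P b'" using clique'[OF y, of b'] e(16) by simp_all
      then show ?thesis using 2 old by (intro bexI[of _ v']) auto
    next
      case 3
      then have "P y = P c'" "P c = P c'" "P a = P c" "P u = P a"
        using clique'[OF y, of c'] e(5,13,17) by simp_all
      then show ?thesis using 3 old by (intro bexI[of _ u]) auto
    qed
  qed
  have reach: "\<exists>z\<in>V - X. P y = P z" if "y \<in> ?W" for y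
    using that attach[of y] attach'[of y] by blast
  show "\<forall>y\<in>?W. \<forall>z\<in>?W. P y = P z"
  proof (intro ballI)
    fix y z assume "y \<in> ?W" "z \<in> ?W"
    then obtain y' z' where "y' \<in> V - X" "z' \<in> V - X" "P y = P y'" "P z = P z'"
      using reach by meson
    then show "P y = P z" using oldP[of y' z'] by simp
  qed
qed

section \<open>The induction step by eight vertices\<close>

lemma in_K4_mono: "in_K4 s y \<Longrightarrow> s \<subseteq> t \<Longrightarrow> in_K4 t y"
  unfolding in_K4_def by (elim exE, intro exI) (erule (1) subset_trans)

lemma in_K4_clique:
  assumes clique: "\<And>p q. p \<in> {a,b,c,d} \<Longrightarrow> q \<in> {a,b,c,d} \<Longrightarrow> p \<noteq> q \<Longrightarrow> (p,q) \<in> s"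
    and "distinct [a,b,c,d]" "y \<in> {a,b,c,d}"
  shows "in_K4 s y"
proof -
  have K: "in_K4 s p" if K: "{p,q,t,w} \<subseteq> {a,b,c,d}" "distinct [p,q,t,w]" for p q t w
  proof -
    have "(p,q) \<in> s" "(p,t) \<in> s" "(p,w) \<in> s" "(q,t) \<in> s" "(t,w) \<in> s" "(w,q) \<in> s"
      by (rule clique; use K in \<open>simp add: eq_commute\<close>)+
    then show ?thesis unfolding in_K4_def by (intro exI[of _ q] exI[of _ t] exI[of _ w]) simp
  qed
  consider "y = a" | "y = b" | "y = c" | "y = d" using assms(3) by blast
  then show ?thesis
  proof cases
    case 1 then show ?thesis using K[of a b c d] assms(2) by auto
  next
    case 2 then show ?thesis using K[of b a c d] assms(2) by auto
  next
    case 3 then show ?thesis using K[of c a b d] assms(2) by auto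
  next
    case 4 then show ?thesis using K[of d a b c] assms(2) by auto
  qed
qed

lemma in_K4_three_nbrs:
  assumes "in_K4 s y" "irrefl s" "s \<subseteq> V \<times> V"
  shows "\<exists>p q t. {p,q,t} \<subseteq> V - {y} \<and> p \<noteq> q \<and> q \<noteq> t \<and> p \<noteq> t \<and> {(y,p),(y,q),(y,t)} \<subseteq> s"
proof -
  obtain a b c where abc: "{(y,a), (y,b), (y,c), (a,b), (b,c), (c,a)} \<subseteq> s"
    using assms(1) unfolding in_K4_def by (elim exE)
  then show ?thesis
    using assms(2,3) by (intro exI[of _ a] exI[of _ b] exI[of _ c]) (auto simp: irrefl_def)
qed

lemma extendableI:
  assumes "r \<subseteq> {..<n} \<times> {..<n}" "irrefl r" "sym r" "card r = 2 * m" "3 < n"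
    and "\<And>X. X \<subseteq> {..<n} \<Longrightarrow> card X < 3 \<Longrightarrow> conn_on ({..<n} - X) (\<lambda>u v. (u,v) \<in> r)"
    and "distinct [u,v,u',v']" "(u,v) \<in> r" "(u',v') \<in> r"
    and "\<And>y. y < n \<Longrightarrow> in_K4 (r - {(u,v),(v,u),(u',v'),(v',u')}) y"
  shows "extendable n m r"
proof -
  have "\<exists>u v u' v'. distinct [u,v,u',v'] \<and> (u,v) \<in> r \<and> (u',v') \<in> r \<and>
      (\<forall>y<n. in_K4 (r - {(u,v),(v,u),(u',v'),(v',u')}) y)"
    using assms(7-10)
    by (rule_tac exI[of _ u], rule_tac exI[of _ v], rule_tac exI[of _ u'], rule_tac exI[of _ v']) blast
  then show ?thesis using assms(1-6) unfolding extendable_def by (intro conjI allI impI)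
qed

lemma extendable_step:
  assumes "extendable n m r"
  shows "\<exists>r'. extendable (n + 8) (m + 15) r'"
proof -
  have r: "r \<subseteq> {..<n} \<times> {..<n}" "irrefl r" "sym r" "card r = 2 * m" "3 < n"
    and conn: "\<And>X. X \<subseteq> {..<n} \<Longrightarrow> card X < 3 \<Longrightarrow> conn_on ({..<n} - X) (\<lambda>u v. (u,v) \<in> r)"
    using assms unfolding extendable_def by blast+
  obtain u v u' v' where uv: "distinct [u,v,u',v']" "(u,v) \<in> r" "(u',v') \<in> r"
    and K4: "\<And>y. y < n \<Longrightarrow> in_K4 (r - {(u,v),(v,u),(u',v'),(v',u')}) y"
    using assms unfolding extendable_def by blast
  have lt: "u < n" "v < n" "u' < n" "v' < n" using uv r(1) by auto
  have fin: "finite r" using r(1) finite_subset by blast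
  define D where "D = {(u,v),(v,u),(u',v'),(v',u')}"
  \<comment> \<open>Only \<open>n\<close> and \<open>n+4\<close> have degree three: every other new
    vertex has one edge leaving its copy, while \<open>u\<close>, \<open>v\<close>,
    \<open>u'\<close>, \<open>v'\<close> keep their degrees. All pairs point upwards, so
    \<open>L\<close> and its converse are disjoint. Seventeen new edges replace two old
    ones.\<close>
  define L where "L = {(n,n+1),(n,n+2),(n,n+3),(n+1,n+2),(n+1,n+3),(n+2,n+3),
    (n+4,n+5),(n+4,n+6),(n+4,n+7),(n+5,n+6),(n+5,n+7),(n+6,n+7),
    (u,n+1),(v,n+2),(u',n+5),(v',n+6),(n+3,n+7)}"
  define r' where "r' = (r - D) \<union> (L \<union> L\<inverse>)"
  \<comment> \<open>An edge between an old and a new vertex lies neither in an old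
    \<open>K\<^sub>4\<close> nor in one of the two new ones, so these edges can serve as the pair
    for the next extension.\<close>
  define D' where "D' = {(u,n+1),(n+1,u),(u',n+5),(n+5,u')}"
  have D: "D \<subseteq> r" "card D = 4"
    using uv r(3) by (auto simp: D_def dest: symD)
  have finL: "finite L" by (simp add: L_def)
  have L17: "card L = 17" using lt uv(1) by (simp add: L_def)
  have "L \<subseteq> {(i,j). i < j \<and> j < n + 8 \<and> n \<le> j}" using lt by (simp add: L_def)
  then have L_lt: "i < j \<and> j < n + 8 \<and> n \<le> j" if "(i,j) \<in> L" for i j
    using that by blast
  have r_lt: "i < n \<and> j < n" if "(i,j) \<in> r" for i j using that r(1) by auto
  have "L \<inter> L\<inverse> = {}" by (auto dest!: L_lt)
  then have "card (L \<union> L\<inverse>) = 34" using L17 finL by (simp add: card_Un_disjoint)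
  moreover have "(r - D) \<inter> (L \<union> L\<inverse>) = {}" by (auto dest!: L_lt r_lt)
  moreover have "4 \<le> card r" using D fin card_mono[of r D] by simp
  ultimately have card_r': "card r' = 2 * (m + 15)"
    using D fin finL r(4) by (simp add: r'_def card_Un_disjoint card_Diff_subset finite_subset)
  have V: "{..<n+8} = {..<n} \<union> {n,n+1,n+2,n+3,n+4,n+5,n+6,n+7}" by auto
  have "irrefl r'" using r(2) by (auto simp: r'_def irrefl_def dest: L_lt)
  moreover have "sym r'"
    using r(3) unfolding r'_def D_def by (intro sym_Un sym_Un_converse) (auto simp: sym_def)
  moreover have "r' \<subseteq> {..<n+8} \<times> {..<n+8}"
    unfolding r'_def by (auto dest!: L_lt r_lt)
  moreover have "conn_on ({..<n+8} - X) (\<lambda>u v. (u,v) \<in> r')" if X: "X \<subseteq> {..<n+8}" "card X < 3" for X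
  proof -
    have "irrefl (r - D)" "r - D \<subseteq> {..<n} \<times> {..<n}" using r by (auto simp: irrefl_def)
    then have nbrs: "\<exists>p q t. {p,q,t} \<subseteq> {..<n} - {y} \<and> p \<noteq> q \<and> q \<noteq> t \<and> p \<noteq> t \<and>
        {(y,p),(y,q),(y,t)} \<subseteq> r - D" if "y \<in> {..<n}" for y
      using K4[of y] that unfolding D_def[symmetric] by (intro in_K4_three_nbrs) auto
    show ?thesis
      unfolding V
    proof (rule conn_on_extension[OF conn _ nbrs, where u = u and v = v and u' = u' and v' = v'])
      show "r \<subseteq> r - D \<union> {(u,v),(v,u),(u',v'),(v',u')}" "r - D \<subseteq> r'"
        by (auto simp: D_def r'_def)
      have "{(n,n+1),(n,n+2),(n,n+3),(n+1,n+2),(n+1,n+3),(n+2,n+3),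
        (n+4,n+5),(n+4,n+6),(n+4,n+7),(n+5,n+6),(n+5,n+7),(n+6,n+7),
        (u,n+1),(v,n+2),(u',n+5),(v',n+6),(n+3,n+7)} \<subseteq> L"
        unfolding L_def by (rule subset_refl)
      also have "L \<subseteq> r'" by (auto simp: r'_def)
      finally show "{(n,n+1),(n,n+2),(n,n+3),(n+1,n+2),(n+1,n+3),(n+2,n+3),
        (n+4,n+5),(n+4,n+6),(n+4,n+7),(n+5,n+6),(n+5,n+7),(n+6,n+7),
        (u,n+1),(v,n+2),(u',n+5),(v',n+6),(n+3,n+7)} \<subseteq> r'" .
      show "X \<subseteq> {..<n} \<union> {n,n+1,n+2,n+3,n+4,n+5,n+6,n+7}" using X(1) V by simp
    qed (use lt uv(1) X(2) in simp_all)
  qed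
  moreover have "in_K4 (r' - D') y" if y: "y < n + 8" for y
  proof -
    have old_new: "(p,q) \<notin> D'" if "n \<le> p" "n \<le> q" for p q
      using that lt by (auto simp: D'_def)
    have clique: "(p,q) \<in> r' - D'"
      if K: "p \<in> K" "q \<in> K" "p \<noteq> q" "\<And>p. p \<in> K \<Longrightarrow> n \<le> p"
        and edges: "\<And>p q. p \<in> K \<Longrightarrow> q \<in> K \<Longrightarrow> p < q \<Longrightarrow> (p,q) \<in> L" for p q K
      using edges[of p q] edges[of q p] K old_new[of p q] by (cases p q rule: linorder_cases) (auto simp: r'_def)
    have "y \<in> {..<n} \<union> {n,n+1,n+2,n+3,n+4,n+5,n+6,n+7}" using y unfolding V[symmetric] by simp
    then consider "y < n" | "y \<in> {n,n+1,n+2,n+3}" | "y \<in> {n+4,n+5,n+6,n+7}" by blast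
    then show ?thesis
    proof cases
      case 1
      have "r - D \<subseteq> r' - D'" by (auto simp: r'_def D'_def dest: r_lt)
      then show ?thesis using in_K4_mono[OF K4[OF 1], folded D_def] by blast
    next
      case 2
      let ?K = "{n,n+1,n+2,n+3}"
      have edges: "(p,q) \<in> L" if "p \<in> ?K" "q \<in> ?K" "p < q" for p q
        using that by (elim insertE emptyE) (simp_all add: L_def)
      have ge: "n \<le> p" if "p \<in> ?K" for p using that by auto
      show ?thesis
      proof (rule in_K4_clique[OF _ _ 2])
        fix p q assume "p \<in> ?K" "q \<in> ?K" "p \<noteq> q"
        then show "(p,q) \<in> r' - D'" using ge edges by (rule clique)
      qed simp
    next
      case 3
      let ?K = "{n+4,n+5,n+6,n+7}"
      have edges: "(p,q) \<in> L" if "p \<in> ?K" "q \<in> ?K" "p < q" for p q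
        using that by (elim insertE emptyE) (simp_all add: L_def)
      have ge: "n \<le> p" if "p \<in> ?K" for p using that by auto
      show ?thesis
      proof (rule in_K4_clique[OF _ _ 3])
        fix p q assume "p \<in> ?K" "q \<in> ?K" "p \<noteq> q"
        then show "(p,q) \<in> r' - D'" using ge edges by (rule clique)
      qed simp
    qed
  qed
  moreover have "distinct [u,n+1,u',n+5]" "(u,n+1) \<in> r'" "(u',n+5) \<in> r'"
    using lt uv(1) by (auto simp: r'_def L_def)
  ultimately have "extendable (n + 8) (m + 15) r'"
    using card_r' unfolding D'_def by (intro extendableI[of r' "n + 8" "m + 15" u "n + 1" u' "n + 5"]) simp_all
  then show ?thesis by blast
qed

section \<open>Extremal graphs of small order\<close>

definition rel_of_rows :: "nat list list \<Rightarrow> (nat \<times> nat) set" where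
  "rel_of_rows rows = (SIGMA i:{..<length rows}. set (rows ! i))"

function (sequential) search :: "nat list list \<Rightarrow> nat list \<Rightarrow> nat list \<Rightarrow> bool" where
  "search rows [] unseen \<longleftrightarrow> unseen = []"
| "search rows (v # todo) unseen \<longleftrightarrow>
     search rows (filter (\<lambda>w. w \<in> set (rows ! v)) unseen @ todo) (filter (\<lambda>w. w \<notin> set (rows ! v)) unseen)"
  by pat_completeness auto
termination
proof (relation "measure (\<lambda>(rows, todo, unseen). length todo + 2 * length unseen)")
  fix rows :: "nat list list" and v todo unseen
  show "((rows, filter (\<lambda>w. w \<in> set (rows ! v)) unseen @ todo, filter (\<lambda>w. w \<notin> set (rows ! v)) unseen),
    rows, v # todo, unseen) \<in> measure (\<lambda>(rows, todo, unseen). length todo + 2 * length unseen)"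
    using sum_length_filter_compl[of "\<lambda>w. w \<in> set (rows ! v)" unseen] by simp
qed simp

text \<open>The value \<open>k\<close> passes from the pending vertices to every vertex found from
  them. The search succeeds only when nothing is left unseen, so the value reaches
  everything.\<close>

lemma search_sound:
  assumes "search rows todo unseen" "set todo \<union> set unseen \<subseteq> W" "W \<subseteq> {..<length rows}"
    and inv: "\<And>u v. u \<in> W \<Longrightarrow> v \<in> W \<Longrightarrow> (u,v) \<in> rel_of_rows rows \<Longrightarrow> P u = P v"
    and "\<And>w. w \<in> set todo \<Longrightarrow> P w = k" "z \<in> set todo \<union> set unseen"
  shows "P z = k"
  using assms
proof (induction rows todo unseen rule: search.induct)
  case (2 rows v todo unseen)
  have v: "P v = k" "v \<in> W" using 2 by auto
  show ?case
  proof (cases "z = v")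
    case False
    show ?thesis
    proof (rule "2.IH")
      show "search rows (filter (\<lambda>w. w \<in> set (rows ! v)) unseen @ todo)
        (filter (\<lambda>w. w \<notin> set (rows ! v)) unseen)" using "2.prems"(1) by simp
      show "P w = k" if w: "w \<in> set (filter (\<lambda>w. w \<in> set (rows ! v)) unseen @ todo)" for w
      proof (cases "w \<in> set todo")
        case False
        then have "w \<in> W" "(v,w) \<in> rel_of_rows rows"
          using w v(2) "2.prems"(2,3) by (auto simp: rel_of_rows_def)
        then show ?thesis using "2.prems"(4)[of v w] v by simp
      qed (use "2.prems"(5) in simp)
    qed (use "2.prems" False in auto)
  qed (use v in simp)
qed simp

fun connected_list :: "nat list list \<Rightarrow> nat list \<Rightarrow> bool" where
  "connected_list rows [] = True"
| "connected_list rows (v # vs) = search rows [v] vs"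

lemma connected_list_sound:
  assumes "connected_list rows vs" "set vs \<subseteq> {..<length rows}"
  shows "conn_on (set vs) (\<lambda>u v. (u,v) \<in> rel_of_rows rows)"
proof (cases vs)
  case (Cons v ws)
  show ?thesis
    unfolding conn_on_def
  proof (intro allI impI ballI)
    fix P :: "nat \<Rightarrow> bool" and y z
    assume inv: "\<forall>u\<in>set vs. \<forall>v\<in>set vs. (u,v) \<in> rel_of_rows rows \<longrightarrow> P u = P v"
      and yz: "y \<in> set vs" "z \<in> set vs"
    have "P w = P v" if "w \<in> set vs" for w
    proof (rule search_sound[where todo = "[v]" and unseen = ws and W = "set vs" and rows = rows])
      show "P u = P v" if "u \<in> set vs" "v \<in> set vs" "(u,v) \<in> rel_of_rows rows" for u v
        using inv that by simp
    qed (use assms Cons that in auto)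
    then show "P y = P z" using yz by simp
  qed
qed (simp add: conn_on_def)

definition simple_rows :: "nat \<Rightarrow> nat list list \<Rightarrow> bool" where
  "simple_rows n rows \<longleftrightarrow> list_all (\<lambda>i. distinct (rows ! i) \<and>
     list_all (\<lambda>j. j < n \<and> j \<noteq> i \<and> i \<in> set (rows ! j)) (rows ! i)) [0..<n]"

text \<open>The range of \<open>q\<close> includes \<open>p\<close>, so the removal of a single
  vertex is covered by the same test as that of a pair.\<close>

definition three_connected_rows :: "nat \<Rightarrow> nat list list \<Rightarrow> bool" where
  "three_connected_rows n rows \<longleftrightarrow> connected_list rows [0..<n] \<and>
     list_all (\<lambda>p. list_all (\<lambda>q. connected_list rows (filter (\<lambda>z. z \<noteq> p \<and> z \<noteq> q) [0..<n]))
       [0..<Suc p]) [0..<n]"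

definition K4_rows :: "nat \<Rightarrow> nat list list \<Rightarrow> (nat \<times> nat) list \<Rightarrow> bool" where
  "K4_rows n rows es \<longleftrightarrow> (let adj = (\<lambda>i j. j \<in> set (rows ! i) \<and> (i,j) \<notin> set es) in
     list_all (\<lambda>y. list_ex (\<lambda>a. adj y a \<and> list_ex (\<lambda>b. adj y b \<and> adj a b \<and>
       list_ex (\<lambda>c. adj y c \<and> adj b c \<and> adj c a) (rows ! y)) (rows ! y)) (rows ! y)) [0..<n])"

definition extendable_check :: "nat \<Rightarrow> nat \<Rightarrow> nat list list \<Rightarrow> nat \<Rightarrow> nat \<Rightarrow> nat \<Rightarrow> nat \<Rightarrow> bool" where
  "extendable_check n m rows u v u' v' \<longleftrightarrow>
     length rows = n \<and> 3 < n \<and> sum_list (map length rows) = 2 * m \<and>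
     simple_rows n rows \<and> three_connected_rows n rows \<and> distinct [u,v,u',v'] \<and>
     u < n \<and> v \<in> set (rows ! u) \<and> u' < n \<and> v' \<in> set (rows ! u') \<and>
     K4_rows n rows [(u,v),(v,u),(u',v'),(v',u')]"

lemma K4_rowsE:
  assumes "K4_rows n rows es" "y < n"
  obtains a b c where "a \<in> set (rows ! y)" "b \<in> set (rows ! y)" "c \<in> set (rows ! y)"
    "b \<in> set (rows ! a)" "c \<in> set (rows ! b)" "a \<in> set (rows ! c)"
    "{(y,a), (y,b), (y,c), (a,b), (b,c), (c,a)} \<inter> set es = {}"
proof -
  have "\<exists>a\<in>set (rows ! y). (a \<in> set (rows ! y) \<and> (y,a) \<notin> set es) \<and>
      (\<exists>b\<in>set (rows ! y). (b \<in> set (rows ! y) \<and> (y,b) \<notin> set es) \<and> (b \<in> set (rows ! a) \<and> (a,b) \<notin> set es) \<and>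
      (\<exists>c\<in>set (rows ! y). (c \<in> set (rows ! y) \<and> (y,c) \<notin> set es) \<and> (c \<in> set (rows ! b) \<and> (b,c) \<notin> set es) \<and>
        (a \<in> set (rows ! c) \<and> (c,a) \<notin> set es)))"
    using assms unfolding K4_rows_def Let_def list_all_iff list_ex_iff by simp
  then show thesis
    by (elim bexE conjE) (rule that; simp)
qed

lemma three_connected_rows_sound:
  assumes "three_connected_rows n rows" "length rows = n" and X: "X \<subseteq> {..<n}" "card X < 3"
  shows "conn_on ({..<n} - X) (\<lambda>u v. (u,v) \<in> rel_of_rows rows)"
proof (cases "X = {}")
  case True
  have "connected_list rows [0..<n]" using assms(1) by (simp add: three_connected_rows_def)
  then show ?thesis
    using connected_list_sound[of rows "[0..<n]"] True assms(2) by (simp add: lessThan_atLeast0)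
next
  case False
  have "finite X" using X(1) finite_subset by blast
  then have "card X = 1 \<or> card X = 2" using X(2) False card_gt_0_iff[of X] by linarith
  then have "\<exists>p q. X = {p,q}" by (auto simp: card_2_iff card_1_singleton_iff)
  then obtain p q where pq: "X = {p,q}" "q \<le> p" by (metis insert_commute nat_le_linear)
  have "connected_list rows (filter (\<lambda>z. z \<noteq> p \<and> z \<noteq> q) [0..<n])"
    using assms(1) pq X(1) by (simp add: three_connected_rows_def list_all_iff del: upt_Suc)
  moreover have "set (filter (\<lambda>z. z \<noteq> p \<and> z \<noteq> q) [0..<n]) = {..<n} - X" using pq by auto
  ultimately show ?thesis
    using connected_list_sound[of rows "filter (\<lambda>z. z \<noteq> p \<and> z \<noteq> q) [0..<n]"] assms(2) by auto
qed

lemma extendable_check_sound: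
  assumes "extendable_check n m rows u v u' v'"
  shows "extendable n m (rel_of_rows rows)"
proof -
  have len: "length rows = n" "3 < n" "sum_list (map length rows) = 2 * m"
    and simple: "simple_rows n rows" and conn: "three_connected_rows n rows"
    and uv: "distinct [u,v,u',v']" "u < n" "v \<in> set (rows ! u)" "u' < n" "v' \<in> set (rows ! u')"
    and K4: "K4_rows n rows [(u,v),(v,u),(u',v'),(v',u')]"
    using assms unfolding extendable_check_def by blast+
  have row: "distinct (rows ! i) \<and> (\<forall>j\<in>set (rows ! i). j < n \<and> j \<noteq> i \<and> i \<in> set (rows ! j))"
    if "i < n" for i
    by (rule bspec[OF simple[unfolded simple_rows_def list_all_iff]]) (use that in simp)
  have wf: "\<And>i. i < n \<Longrightarrow> distinct (rows ! i)"
      "\<And>i j. i < n \<Longrightarrow> j \<in> set (rows ! i) \<Longrightarrow> j < n \<and> j \<noteq> i \<and> i \<in> set (rows ! j)"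
    using row by blast+
  have sub: "rel_of_rows rows \<subseteq> {..<n} \<times> {..<n}" using wf(2) unfolding rel_of_rows_def len by blast
  have iff: "(i,j) \<in> rel_of_rows rows \<longleftrightarrow> i < n \<and> j \<in> set (rows ! i)" for i j
    by (simp add: rel_of_rows_def len)
  have "card (rel_of_rows rows) = (\<Sum>i<n. card (set (rows ! i)))"
    unfolding rel_of_rows_def len by (rule card_SigmaI) auto
  also have "\<dots> = (\<Sum>i<n. length (rows ! i))"
    using wf(1) by (intro sum.cong) (auto simp: distinct_card)
  also have "\<dots> = 2 * m"
    using len by (simp add: sum_list_sum_nth lessThan_atLeast0)
  finally have card: "card (rel_of_rows rows) = 2 * m" .
  have "in_K4 (rel_of_rows rows - {(u,v),(v,u),(u',v'),(v',u')}) y" if y: "y < n" for y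
  proof -
    obtain a b c where abc: "a \<in> set (rows ! y)" "b \<in> set (rows ! y)" "c \<in> set (rows ! y)"
      "b \<in> set (rows ! a)" "c \<in> set (rows ! b)" "a \<in> set (rows ! c)"
      and avoid: "{(y,a), (y,b), (y,c), (a,b), (b,c), (c,a)} \<inter> set [(u,v),(v,u),(u',v'),(v',u')] = {}"
      by (rule K4_rowsE[OF K4 y]) (rule that)
    have "a < n" "b < n" "c < n" using wf(2) abc(1-3) y by blast+
    then have "{(y,a), (y,b), (y,c), (a,b), (b,c), (c,a)} \<subseteq> rel_of_rows rows"
      using y abc by (simp add: iff)
    then have "{(y,a), (y,b), (y,c), (a,b), (b,c), (c,a)} \<subseteq>
        rel_of_rows rows - set [(u,v),(v,u),(u',v'),(v',u')]"
      using avoid by blast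
    then show ?thesis unfolding in_K4_def list.set by (intro exI)
  qed
  moreover have "irrefl (rel_of_rows rows)" "sym (rel_of_rows rows)"
    using wf(2) unfolding irrefl_def sym_def iff by blast+
  ultimately show ?thesis
    using sub card three_connected_rows_sound[OF conn len(1)] len uv by (intro extendableI[of _ n m u v u' v']) (simp_all add: iff)
qed

text \<open>These graphs consist of complete graphs on four vertices, two of which may share a triangle
  (orders 9 and 13), an edge (10 and 14) or a vertex (11 and 15), and of a few edges joining them.\<close>
lemma extendable_8: "\<exists>r. extendable 8 15 r"
proof -
  have "extendable_check 8 15
    [[1,2,3],
     [0,2,3,5],
     [0,1,3,6],
     [0,1,2,7],
     [5,6,7],
     [1,4,6,7],
     [2,4,5,7],
     [3,4,5,6]]
    1 5 2 6"
    by code_simp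
  then show ?thesis by (blast intro: extendable_check_sound)
qed

text \<open>The three shared vertices have degree five. In the terms of the lower bound
  \<open>E = E' = 3\<close> and \<open>R = {}\<close>, so the defect is
  \<open>4 * 3 - 3 = 9\<close>, the least value possible for this residue after the excluded
  1.\<close>

lemma extendable_9: "\<exists>r. extendable 9 18 r"
proof -
  have "extendable_check 9 18
    [[1,2,3],
     [0,2,3,4,6],
     [0,1,3,4,7],
     [0,1,2,4,8],
     [1,2,3],
     [6,7,8],
     [1,5,7,8],
     [2,5,6,8],
     [3,5,6,7]]
    1 6 2 7"
    by code_simp
  then show ?thesis by (blast intro: extendable_check_sound)
qed

lemma extendable_10: "\<exists>r. extendable 10 20 r"
proof -
  have "extendable_check 10 20
    [[1,2,3],
     [0,2,3,4,5,9],
     [0,1,3,4,5],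
     [0,1,2,7],
     [1,2,5],
     [1,2,4,8],
     [7,8,9],
     [3,6,8,9],
     [5,6,7,9],
     [1,6,7,8]]
    1 9 3 7"
    by code_simp
  then show ?thesis by (blast intro: extendable_check_sound)
qed

lemma extendable_11: "\<exists>r. extendable 11 22 r"
proof -
  have "extendable_check 11 22
    [[1,2,3],
     [0,2,3,8],
     [0,1,3,6,10],
     [0,1,2,4,5,6],
     [3,5,6],
     [3,4,6,9],
     [2,3,4,5],
     [8,9,10],
     [1,7,9,10],
     [5,7,8,10],
     [2,7,8,9]]
    1 8 2 6"
    by code_simp
  then show ?thesis by (blast intro: extendable_check_sound)
qed

text \<open>The block \<open>{0,1,2,3}\<close> has all degrees four and no neighbour of degree
  three: it is the four-element \<open>R\<close> of \<open>four_regular_R\<close> and accounts for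
  the defect 4. Such a block added to the shapes for orders 9 and 10 gives those for 13 and
  14.\<close>

lemma extendable_12: "\<exists>r. extendable 12 23 r"
proof -
  have "extendable_check 12 23
    [[1,2,3,10],
     [0,2,3,5],
     [0,1,3,6],
     [0,1,2,9],
     [5,6,7],
     [1,4,6,7],
     [2,4,5,7],
     [4,5,6,11],
     [9,10,11],
     [3,8,10,11],
     [0,8,9,11],
     [7,8,9,10]]
    0 10 1 5"
    by code_simp
  then show ?thesis by (blast intro: extendable_check_sound)
qed

lemma extendable_13: "\<exists>r. extendable 13 26 r"
proof -
  have "extendable_check 13 26
    [[1,2,3,11],
     [0,2,3,5],
     [0,1,3,6],
     [0,1,2,10],
     [5,6,7],
     [1,4,6,7,8],
     [2,4,5,7,8],
     [4,5,6,8,12],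
     [5,6,7],
     [10,11,12],
     [3,9,11,12],
     [0,9,10,12],
     [7,9,10,11]]
    0 11 1 5"
    by code_simp
  then show ?thesis by (blast intro: extendable_check_sound)
qed

lemma extendable_14: "\<exists>r. extendable 14 28 r"
proof -
  have "extendable_check 14 28
    [[1,2,3,12],
     [0,2,3,7],
     [0,1,3,9],
     [0,1,2,11],
     [5,6,7],
     [4,6,7,8,9,13],
     [4,5,7,8,9],
     [1,4,5,6],
     [5,6,9],
     [2,5,6,8],
     [11,12,13],
     [3,10,12,13],
     [0,10,11,13],
     [5,10,11,12]]
    0 12 1 7"
    by code_simp
  then show ?thesis by (blast intro: extendable_check_sound)
qed

text \<open>Vertex 3 is shared by two copies of \<open>K\<^sub>4\<close> and has degree six, so
  \<open>E = 2\<close>, \<open>E' = 1\<close> and the defect is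
  \<open>4 * 2 - 1 = 7\<close>.\<close>

lemma extendable_15: "\<exists>r. extendable 15 29 r"
proof -
  have "extendable_check 15 29
    [[1,2,3],
     [0,2,3,8],
     [0,1,3,12],
     [0,1,2,4,5,6],
     [3,5,6],
     [3,4,6,9],
     [3,4,5,13],
     [8,9,10],
     [1,7,9,10],
     [5,7,8,10],
     [7,8,9,14],
     [12,13,14],
     [2,11,13,14],
     [6,11,12,14],
     [10,11,12,13]]
    1 8 2 12"
    by code_simp
  then show ?thesis by (blast intro: extendable_check_sound)
qed

section \<open>The minimum size\<close>

lemma extremal_f_add_8: "extremal_f (n + 8) = extremal_f n + 15"
proof -
  \<comment> \<open>This keeps the truncated subtraction in \<open>extremal_f\<close> exact.\<close>
  have "n div 8 \<le> 2 * n" by linarith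
  then show ?thesis by (simp add: extremal_f_def add.commute)
qed

lemma ex_extendable:
  assumes "8 \<le> n" shows "\<exists>r. extendable n (extremal_f n) r"
  using assms
proof (induction n rule: less_induct)
  case (less n)
  show ?case
  proof (cases "n < 16")
    case True
    then consider "n = 8" | "n = 9" | "n = 10" | "n = 11" | "n = 12" | "n = 13" | "n = 14" | "n = 15"
      using less.prems by linarith
    then show ?thesis
      by cases (simp_all add: extremal_f_def extendable_8 extendable_9 extendable_10 extendable_11
          extendable_12 extendable_13 extendable_14 extendable_15)
  next
    case False
    then obtain k where k: "n = k + 8" "8 \<le> k"
      using that[of "n - 8"] by simp
    then obtain r where "extendable k (extremal_f k) r" using less.IH[of k] by auto
    then show ?thesis using extendable_step k by (simp add: extremal_f_add_8)
  qed
qed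

theorem theorem1:
  fixes n :: nat
  assumes "8 \<le> n"
  shows "(\<forall>G :: ('a, 'b) pre_digraph.
            graph G \<and> k_connected 3 G \<and> locally_nonforesty G \<and> graph_order G = n
              \<longrightarrow> extremal_f n \<le> graph_size G) \<and>
         (\<exists>G :: (nat, nat \<times> nat) pre_digraph.
            graph G \<and> k_connected 3 G \<and> locally_nonforesty G \<and> graph_order G = n
              \<and> graph_size G = extremal_f n)"
proof (intro conjI allI impI)
  fix G :: "('a, 'b) pre_digraph"
  assume G: "graph G \<and> k_connected 3 G \<and> locally_nonforesty G \<and> graph_order G = n"
  then interpret graph G by blast
  show "extremal_f n \<le> graph_size G"
    using extremal_f_le_graph_size G assms by blast
next
  obtain r where "extendable n (extremal_f n) r" using ex_extendable[OF assms] by blast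
  from extendable_realization[OF this]
  show "\<exists>G :: (nat, nat \<times> nat) pre_digraph.
      graph G \<and> k_connected 3 G \<and> locally_nonforesty G \<and> graph_order G = n \<and> graph_size G = extremal_f n"
    by blast
qed

end
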